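(* Let $n\ge 1$. Then $$\sum_{R\in R(\mathcal{S}^A_n)} q^{c(R)}=\sum_{R\in R(\mathcal{S}^A_n)} q^{f(R)}=\frac{1}{n+1}\sum_{\mathbf{a}\in\mathcal{A}(n)} q^{\,n-d(\mathbf{a})}=\sum_{\mathbf{a}\in PF(n)} q^{\,n-d(\mathbf{a})}$$ as polynomials in $q$, where $\mathcal{S}^A_n$ is the type $A_{n-1}$ Shi arrangement in $\mathbb{R}^n$, $c(R)$ and $f(R)$ are the numbers of ceilings and floors of the region $R$, $\mathcal{A}(n)=[n+1]^n$, $PF(n)$ is the set of parking functions of length $n$, and $d(\mathbf{a})$ is the number of distinct numbers contained in the sequence $\mathbf{a}$.
   Context: $[m]=\{1,\dots,m\}$. A hyperplane arrangement is a finite set $\mathcal{H}$ of affine hyperplanes in $\mathbb{R}^n$; its regions are the connected components of $\mathbb{R}^n\setminus\bigcup_{H\in\mathcal{H}}H$, and $R(\mathcal{H})$ denotes the set of regions. The type $A_{n-1}$ Shi arrangement is $\mathcal{S}^A_n=\{x_i-x_j=0 \mid 1\le i<j\le n\}\cup\{x_i-x_j=1\mid 1\le i<j\le n\}$ in $\mathbb{R}^n$. A hyperplane $H$ of the arrangement is a wall of a region $R$ if it is the affine span of a codimension-1 face of $R$. A wall $H$ of $R$ is a floor if $H$ does not contain the origin and $R$ and the origin lie in opposite half-spaces defined by $H$; it is a ceiling if $H$ does not contain the origin and $R$ and the origin lie in the same half-space defined by $H$. $f(R)$ is the number of floors and $c(R)$ the number of ceilings of $R$. $\mathcal{A}(n)=\{(a_1,\dots,a_n)\mid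 a_i\in[n+1],\ i\in[n]\}$. A sequence $(a_1,\dots,a_n)\in[n]^n$ is a parking function if its increasing rearrangement $b_1\le\dots\le b_n$ satisfies $b_i\le i$ for all $i$; $PF(n)$ is the set of parking functions of length $n$. $d(\mathbf{a})$ is the number of distinct numbers contained in the sequence $\mathbf{a}$. *)

theory Defs
  imports "HOL-Analysis.Analysis" "HOL-Computational_Algebra.Polynomial"
begin

definition regions :: "'a::euclidean_space set set \<Rightarrow> 'a set set" where
  "regions \<H> = components (UNIV - \<Union>\<H>)"

text \<open>Regions are open, so the faces of a region are the faces of the closed convex polyhedron
  obtained as its closure. A facet is a face of codimension one.\<close>

definition is_wall :: "'a::euclidean_space set set \<Rightarrow> 'a set \<Rightarrow> 'a set \<Rightarrow> bool" where
  "is_wall \<H> R H \<longleftrightarrow> H \<in> \<H> \<and> (\<exists>F. F facet_of closure R \<and> affine hull F = H)"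

text \<open>Since the pair \<open>(a, b)\<close> may be replaced by \<open>(- a, - b)\<close>, fixing the side on which the
  origin lies is no restriction.\<close>

definition opposite_sides :: "'a::euclidean_space set \<Rightarrow> 'a set \<Rightarrow> bool" where
  "opposite_sides H R \<longleftrightarrow>
     (\<exists>a b. a \<noteq> 0 \<and> H = {x. a \<bullet> x = b} \<and> 0 \<in> {x. a \<bullet> x < b} \<and> R \<subseteq> {x. a \<bullet> x > b})"

definition same_side :: "'a::euclidean_space set \<Rightarrow> 'a set \<Rightarrow> bool" where
  "same_side H R \<longleftrightarrow>
     (\<exists>a b. a \<noteq> 0 \<and> H = {x. a \<bullet> x = b} \<and> 0 \<in> {x. a \<bullet> x < b} \<and> R \<subseteq> {x. a \<bullet> x < b})"

definition floors :: "'a::euclidean_space set set \<Rightarrow> 'a set \<Rightarrow> 'a set set" where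
  "floors \<H> R = {H. is_wall \<H> R H \<and> 0 \<notin> H \<and> opposite_sides H R}"

definition ceilings :: "'a::euclidean_space set set \<Rightarrow> 'a set \<Rightarrow> 'a set set" where
  "ceilings \<H> R = {H. is_wall \<H> R H \<and> 0 \<notin> H \<and> same_side H R}"

text \<open>The coordinates are indexed by a finite linearly ordered type \<open>'n\<close>, playing the role of
  \<open>{1, \<dots>, n}\<close> with \<open>n = CARD('n)\<close>; every \<open>n \<ge> 1\<close> is the cardinality of such a type.\<close>

definition shi_arrangement :: "(real ^ 'n::{finite,linorder}) set set" where
  "shi_arrangement =
     {{x. x $ i - x $ j = 0} | i j. i < j} \<union> {{x. x $ i - x $ j = 1} | i j. i < j}"

definition all_sequences :: "nat \<Rightarrow> nat list set" where
  "all_sequences n = {a. length a = n \<and> set a \<subseteq> {1..n + 1}}"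

text \<open>List positions start at 0, whence the bound \<open>i + 1\<close>.\<close>

definition parking_functions :: "nat \<Rightarrow> nat list set" where
  "parking_functions n =
     {a. length a = n \<and> set a \<subseteq> {1..n} \<and> (\<forall>i<n. sort a ! i \<le> i + 1)}"

definition num_distinct :: "nat list \<Rightarrow> nat" where
  "num_distinct a = card (set a)"

end

theory Submission
  imports Defs
begin

text \<open>Order the coordinates of a point of a region decreasingly and let \<open>w\<close> be the resulting word of
indices. Among the hyperplanes \<open>x\<^sub>i - x\<^sub>j = 1\<close> with \<open>i < j\<close> only those whose \<open>i\<close> comes before \<open>j\<close> in
\<open>w\<close> (the ascents of \<open>w\<close>) can still separate such points, so that the region is determined by
\<open>w\<close> and the set \<open>N\<close> of ascents \<open>(i, j)\<close> with \<open>x\<^sub>i - x\<^sub>j < 1\<close>. If one ascent lies inside another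
in \<open>w\<close>, its difference is smaller; hence \<open>N\<close> is a down-set for nesting, and every down-set occurs
(\<open>near_relation_realizable\<close>, by choosing the coordinates one at a time), so that regions
correspond to pairs of a word and a down-set (\<open>regions_shi\<close>).

Crossing a wall off the origin moves exactly one ascent into or out of \<open>N\<close>. Therefore the
ceilings are the outermost members of \<open>N\<close> and the floors are the innermost ascents outside \<open>N\<close>
(\<open>ceiling_iff_maximal\<close>, \<open>floor_iff_minimal\<close>). In a finite order the maximal elements of a down-set
and the minimal elements of its complement both range bijectively over the antichains. So both
region sums equal the sum of \<open>q\<^bsup>|A|\<^esup>\<close> over all arc diagrams: words \<open>w\<close> with a set \<open>A\<close> of ascents
no two of which are nested.

Nonnesting arcs behave like a queue: read from left to right, the arcs that opened first close
first. The arcs link the letters into increasing chains, \<open>n - |A|\<close> of them. Record each chain as a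
block at the position of its first letter and leave the other positions empty. From the sequence
of blocks the word is recovered by serving a queue: at a position with a block its first
letter is served and the rest of the block joins the end of the queue, and at an empty position
the block at the head of the queue is served and rejoins at the end. The queue never runs dry
exactly if the blocks at the first \<open>p\<close> positions have at least \<open>p\<close> letters, for every \<open>p\<close>; this is the condition
for the function sending a letter to the position of its block to be a parking function
\<open>a\<close>, and \<open>d(a)\<close> is the number of nonempty blocks. This gives the sum over parking functions
(\<open>sum_arc_diagrams_eq_blocks\<close>, \<open>sum_blocks_eq_parking\<close>).

Finally, the cyclic shifts of the values of a sequence modulo \<open>n + 1\<close> do not change the number of
distinct values, and among the \<open>n + 1\<close> shifts exactly one is a parking function
(\<open>bij_betw_parking_rotations\<close>, by the cycle lemma). This is Pollak's argument.\<close>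

section \<open>Pairs of letters in a word\<close>

fun before :: "'a list \<Rightarrow> ('a \<times> 'a) set" where
  "before [] = {}"
| "before (x # u) = {x} \<times> set u \<union> before u"

text \<open>The order on arcs: in a pair of \<open>nested w\<close> the first arc lies inside the second, different one.\<close>

definition nested :: "'a list \<Rightarrow> (('a \<times> 'a) \<times> ('a \<times> 'a)) set" where
  "nested w = {((i, j), (k, l)). (i, j) \<noteq> (k, l) \<and>
     (k = i \<or> (k, i) \<in> before w) \<and> (j = l \<or> (j, l) \<in> before w)}"

lemma before_subset: "before u \<subseteq> set u \<times> set u"
  by (induction u) auto

lemma before_append: "before (u @ v) = before u \<union> set u \<times> set v \<union> before v"
  by (induction u) auto

lemma before_filter: "before (filter P u) = before u \<inter> {x. P x} \<times> {x. P x}"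
  by (induction u) auto

lemma before_irrefl: "distinct u \<Longrightarrow> (x, x) \<notin> before u"
  by (induction u) (auto dest: subsetD[OF before_subset])

lemma before_trans:
  "distinct u \<Longrightarrow> (x, y) \<in> before u \<Longrightarrow> (y, z) \<in> before u \<Longrightarrow> (x, z) \<in> before u"
  by (induction u) (auto dest: subsetD[OF before_subset])

lemma before_asym: "distinct u \<Longrightarrow> (x, y) \<in> before u \<Longrightarrow> (y, x) \<notin> before u"
  using before_trans before_irrefl by metis

lemma before_total:
  "x \<in> set u \<Longrightarrow> y \<in> set u \<Longrightarrow> x \<noteq> y \<Longrightarrow> (x, y) \<in> before u \<or> (y, x) \<in> before u"
  by (induction u) auto

definition ascents :: "'a::linorder list \<Rightarrow> ('a \<times> 'a) set" where
  "ascents w = {(i, j) \<in> before w. i < j}"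

lemma finite_ascents: "finite (ascents w)"
  by (rule finite_subset[of _ "set w \<times> set w"]) (use before_subset in \<open>auto simp: ascents_def\<close>)

lemma irrefl_nested: "irrefl (nested w)"
  by (auto simp: irrefl_def nested_def)

lemma trans_nested:
  assumes "distinct w"
  shows "trans (nested w)"
proof (rule transI)
  note tr = before_trans[OF assms] and asy = before_asym[OF assms]
  fix a b c assume *: "(a, b) \<in> nested w" "(b, c) \<in> nested w"
  obtain i j k l p q where s: "a = (i, j)" "b = (k, l)" "c = (p, q)" by (metis surj_pair)
  have "p = i \<or> (p, i) \<in> before w" "j = q \<or> (j, q) \<in> before w"
    using * tr unfolding s nested_def by blast+
  moreover have "(i, j) \<noteq> (p, q)" using * asy unfolding s nested_def by blast
  ultimately show "(a, c) \<in> nested w" by (simp add: s nested_def)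
qed

section \<open>Down-sets and antichains of a finite order\<close>

definition down_sets :: "'b set \<Rightarrow> 'b rel \<Rightarrow> 'b set set" where
  "down_sets P r = {N. N \<subseteq> P \<and> (\<forall>b\<in>N. \<forall>a\<in>P. (a, b) \<in> r \<longrightarrow> a \<in> N)}"

definition antichains :: "'b set \<Rightarrow> 'b rel \<Rightarrow> 'b set set" where
  "antichains P r = {A. A \<subseteq> P \<and> (\<forall>a\<in>A. \<forall>b\<in>A. (a, b) \<notin> r)}"

definition maximal :: "'b rel \<Rightarrow> 'b set \<Rightarrow> 'b set" where
  "maximal r N = {a \<in> N. \<forall>b\<in>N. (a, b) \<notin> r}"

text \<open>The converse of a transitive irreflexive relation is well-founded on a finite set, so that among the
elements above \<open>a\<close> there is one with nothing above it.\<close>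

lemma below_maximal:
  assumes "finite N" "trans r" "irrefl r" "a \<in> N" "a \<notin> maximal r N"
  shows "\<exists>b\<in>maximal r N. (a, b) \<in> r"
proof -
  let ?B = "{b \<in> N. (a, b) \<in> r}"
  have "trans (r\<inverse>)" using assms(2) by (auto simp: trans_def)
  then have acy: "acyclic (r\<inverse>)" using assms(3) by (simp add: acyclic_irrefl trancl_id irrefl_def)
  have "finite (Restr (r\<inverse>) N)" using assms(1) by (auto intro: finite_subset[of _ "N \<times> N"])
  then have "wf (Restr (r\<inverse>) N)" using acy by (metis Int_lower1 acyclic_subset finite_acyclic_wf)
  moreover obtain b0 where "b0 \<in> ?B" using assms(4,5) by (auto simp: maximal_def)
  ultimately obtain b where b: "b \<in> ?B" "\<And>c. (c, b) \<in> Restr (r\<inverse>) N \<Longrightarrow> c \<notin> ?B"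
    by (rule wfE_min) blast
  have "(b, c) \<notin> r" if "c \<in> N" for c
    using b that assms(2) by (auto dest: transD)
  then show ?thesis using b(1) by (auto simp: maximal_def)
qed

text \<open>A down-set is recovered from its maximal elements as the set of everything below them.\<close>

lemma bij_betw_maximal:
  assumes "finite P" "trans r" "irrefl r"
  shows "bij_betw (maximal r) (down_sets P r) (antichains P r)"
proof (rule bij_betw_byWitness[where f' = "\<lambda>A. {a \<in> P. a \<in> A \<or> (\<exists>b\<in>A. (a, b) \<in> r)}"])
  show "\<forall>N\<in>down_sets P r. {a \<in> P. a \<in> maximal r N \<or> (\<exists>b\<in>maximal r N. (a, b) \<in> r)} = N"
  proof
    fix N assume N: "N \<in> down_sets P r"
    then have "finite N" using assms(1) by (auto simp: down_sets_def intro: finite_subset)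
    note bm = below_maximal[OF this assms(2,3)]
    show "{a \<in> P. a \<in> maximal r N \<or> (\<exists>b\<in>maximal r N. (a, b) \<in> r)} = N"
    proof
      show "{a \<in> P. a \<in> maximal r N \<or> (\<exists>b\<in>maximal r N. (a, b) \<in> r)} \<subseteq> N"
        using N by (auto simp: down_sets_def maximal_def)
      show "N \<subseteq> {a \<in> P. a \<in> maximal r N \<or> (\<exists>b\<in>maximal r N. (a, b) \<in> r)}"
        using N bm by (auto simp: down_sets_def)
    qed
  qed
  show "\<forall>A\<in>antichains P r. maximal r {a \<in> P. a \<in> A \<or> (\<exists>b\<in>A. (a, b) \<in> r)} = A"
    using assms(2) by (auto simp: antichains_def maximal_def dest: transD)
  show "maximal r ` down_sets P r \<subseteq> antichains P r"
    by (auto simp: down_sets_def antichains_def maximal_def)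
  show "(\<lambda>A. {a \<in> P. a \<in> A \<or> (\<exists>b\<in>A. (a, b) \<in> r)}) ` antichains P r \<subseteq> down_sets P r"
    using assms(2) by (auto simp: down_sets_def antichains_def dest: transD)
qed

text \<open>Complements of down-sets are the down-sets of the converse order, and an antichain for an order is
one for its converse. Hence maximal elements and minimal non-elements have the same
distribution over the down-sets, which is what makes ceilings and floors equidistributed.\<close>

lemma bij_betw_minimal_complement:
  assumes "finite P" "trans r" "irrefl r"
  shows "bij_betw (\<lambda>N. maximal (r\<inverse>) (P - N)) (down_sets P r) (antichains P r)"
proof -
  have "bij_betw (\<lambda>N. P - N) (down_sets P r) (down_sets P (r\<inverse>))"
    by (rule bij_betw_byWitness[where f' = "\<lambda>N. P - N"]) (auto simp: down_sets_def)
  moreover have "bij_betw (maximal (r\<inverse>)) (down_sets P (r\<inverse>)) (antichains P (r\<inverse>))"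
    using assms by (intro bij_betw_maximal) (auto simp: irrefl_def trans_def)
  moreover have "antichains P (r\<inverse>) = antichains P r" by (auto simp: antichains_def)
  ultimately show ?thesis using bij_betw_trans by (fastforce simp: comp_def)
qed

section \<open>Facets and sides of polyhedra given by strict inequalities\<close>

text \<open>Inequalities are indexed rather than collected in a set of half-spaces, so that a single one can be
dropped and its normal vector named.\<close>

definition strict_polyhedron :: "'k set \<Rightarrow> ('k \<Rightarrow> 'a::euclidean_space) \<Rightarrow> ('k \<Rightarrow> real) \<Rightarrow> 'a set" where
  "strict_polyhedron K a b = {x. \<forall>k\<in>K. a k \<bullet> x < b k}"

lemma open_strict_polyhedron: "finite K \<Longrightarrow> open (strict_polyhedron K a b)"
proof -
  assume K: "finite K"
  have "strict_polyhedron K a b = (\<Inter>k\<in>K. {x. a k \<bullet> x < b k})"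
    by (auto simp: strict_polyhedron_def)
  then show ?thesis using K by (auto intro: open_halfspace_lt)
qed

lemma convex_strict_polyhedron: "convex (strict_polyhedron K a b)"
proof -
  have "strict_polyhedron K a b = (\<Inter>k\<in>K. {x. a k \<bullet> x < b k})"
    by (auto simp: strict_polyhedron_def)
  then show ?thesis by (auto intro!: convex_INT convex_halfspace_lt)
qed

text \<open>A point satisfying the weak inequalities is the limit of points on the segment from it to a point of
the polyhedron, and these satisfy the strict ones.\<close>

lemma closure_strict_polyhedron:
  assumes "strict_polyhedron K a b \<noteq> {}"
  shows "closure (strict_polyhedron K a b) = {x. \<forall>k\<in>K. a k \<bullet> x \<le> b k}"
proof
  have "{x. \<forall>k\<in>K. a k \<bullet> x \<le> b k} = (\<Inter>k\<in>K. {x. a k \<bullet> x \<le> b k})" by auto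
  then have "closed {x. \<forall>k\<in>K. a k \<bullet> x \<le> b k}" by (auto intro: closed_halfspace_le)
  then show "closure (strict_polyhedron K a b) \<subseteq> {x. \<forall>k\<in>K. a k \<bullet> x \<le> b k}"
    by (rule closure_minimal[rotated]) (force simp: strict_polyhedron_def)
next
  obtain c where c: "c \<in> strict_polyhedron K a b" using assms by auto
  show "{x. \<forall>k\<in>K. a k \<bullet> x \<le> b k} \<subseteq> closure (strict_polyhedron K a b)"
  proof
    fix y assume y: "y \<in> {x. \<forall>k\<in>K. a k \<bullet> x \<le> b k}"
    define f where "f = (\<lambda>n. y + inverse (real (Suc n)) *\<^sub>R (c - y))"
    have "f n \<in> strict_polyhedron K a b" for n
      unfolding strict_polyhedron_def
    proof (intro CollectI ballI)
      fix k assume k: "k \<in> K"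
      define t where "t = inverse (real (Suc n))"
      have t: "0 < t" "t \<le> 1" by (auto simp: t_def field_simps)
      have 1: "a k \<bullet> y \<le> b k" "a k \<bullet> c < b k" using y c k by (auto simp: strict_polyhedron_def)
      have "f n = (1 - t) *\<^sub>R y + t *\<^sub>R c"
        by (simp only: f_def t_def[symmetric]) (simp add: algebra_simps)
      then have "a k \<bullet> f n = (1 - t) * (a k \<bullet> y) + t * (a k \<bullet> c)"
        by (simp add: inner_simps)
      also have "\<dots> < (1 - t) * b k + t * b k"
        using t 1 by (intro add_le_less_mono mult_left_mono mult_strict_left_mono) auto
      finally show "a k \<bullet> f n < b k" by (simp add: algebra_simps)
    qed
    moreover have "f \<longlonglongrightarrow> y + 0 *\<^sub>R (c - y)"
      unfolding f_def by (intro tendsto_intros LIMSEQ_inverse_real_of_nat)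
    ultimately show "y \<in> closure (strict_polyhedron K a b)"
      unfolding closure_sequential by auto
  qed
qed

text \<open>A relative interior point of the facet works: a linear functional that attains its maximum over a
convex set in the relative interior is constant on that set, so an inequality that is tight
at this point is tight on the whole affine span of the facet.\<close>

lemma facet_point:
  assumes "strict_polyhedron K a b \<noteq> {}"
    and "F facet_of closure (strict_polyhedron K a b)"
  obtains z where "z \<in> affine hull F"
    "\<And>k. k \<in> K \<Longrightarrow> \<not> affine hull F \<subseteq> {x. a k \<bullet> x = b k} \<Longrightarrow> a k \<bullet> z < b k"
proof -
  have F: "F face_of closure (strict_polyhedron K a b)" "F \<noteq> {}"
    using assms(2) by (auto simp: facet_of_def)
  have conv: "convex F" using F(1) by (rule face_of_imp_convex)
  then obtain z where z: "z \<in> rel_interior F" using F(2) rel_interior_eq_empty by blast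
  have zF: "z \<in> F" using z rel_interior_subset by blast
  have le: "a k \<bullet> x \<le> b k" if "x \<in> F" "k \<in> K" for x k
    using face_of_imp_subset[OF F(1)] that closure_strict_polyhedron[OF assms(1)] by blast
  show thesis
  proof
    show "z \<in> affine hull F" using zF by (rule hull_inc)
    fix k assume k: "k \<in> K" "\<not> affine hull F \<subseteq> {x. a k \<bullet> x = b k}"
    show "a k \<bullet> z < b k"
    proof (rule ccontr)
      assume "\<not> a k \<bullet> z < b k"
      then have eq: "a k \<bullet> z = b k" using le[OF zF k(1)] by simp
      have "F \<subseteq> {x. a k \<bullet> x = b k}"
      proof
        fix x assume x: "x \<in> F"
        then obtain e where e: "e > 1" "(1 - e) *\<^sub>R x + e *\<^sub>R z \<in> F"
          using z convex_rel_interior_iff[OF conv F(2)] by blast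
        have "(1 - e) * (a k \<bullet> x) + e * b k \<le> b k"
          using le[OF e(2) k(1)] eq by (simp add: inner_simps)
        then have "(e - 1) * b k \<le> (e - 1) * (a k \<bullet> x)" by (simp add: algebra_simps)
        then have "b k \<le> a k \<bullet> x" using e(1) by simp
        then show "x \<in> {x. a k \<bullet> x = b k}" using le[OF x k(1)] by simp
      qed
      then have "affine hull F \<subseteq> {x. a k \<bullet> x = b k}"
        by (rule hull_minimal) (rule affine_hyperplane)
      then show False using k(2) by blast
    qed
  qed
qed

text \<open>Near \<open>z\<close> the hyperplane lies in the closure, so the exposed face that it cuts out spans it.\<close>

lemma facet_of_point:
  assumes "finite K" "strict_polyhedron K a b \<noteq> {}" "k0 \<in> K" "a k0 \<noteq> 0"
    and z: "a k0 \<bullet> z = b k0" "\<And>k. k \<in> K \<Longrightarrow> k \<noteq> k0 \<Longrightarrow> a k \<bullet> z < b k"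
  shows "\<exists>F. F facet_of closure (strict_polyhedron K a b) \<and> affine hull F = {x. a k0 \<bullet> x = b k0}"
proof -
  let ?C = "strict_polyhedron K a b" and ?H = "{x. a k0 \<bullet> x = b k0}"
  let ?T = "strict_polyhedron (K - {k0}) a b"
  define F where "F = closure ?C \<inter> ?H"
  note cl = closure_strict_polyhedron[OF assms(2)]
  have face: "F face_of closure ?C" unfolding F_def
    using assms(3) by (intro face_of_Int_supporting_hyperplane_le convex_closure convex_strict_polyhedron)
      (simp add: cl)
  have "affine hull (?H \<inter> ?T) = affine hull ?H"
  proof (rule affine_hull_affine_Int_open)
    show "affine ?H" by (rule affine_hyperplane)
    show "open ?T" using assms(1) by (intro open_strict_polyhedron) simp
    show "?H \<inter> ?T \<noteq> {}" using z by (auto simp: strict_polyhedron_def)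
  qed
  then have HT: "affine hull (?H \<inter> ?T) = ?H" by (simp add: affine_hyperplane hull_same)
  have "?H \<inter> ?T \<subseteq> F" 
  proof
    fix x assume x: "x \<in> ?H \<inter> ?T"
    have "a k \<bullet> x \<le> b k" if "k \<in> K" for k
      using x that by (cases "k = k0") (auto simp: strict_polyhedron_def intro: less_imp_le)
    then show "x \<in> F" using x by (simp add: F_def cl)
  qed
  then have "?H \<subseteq> affine hull F" using HT hull_mono by metis
  moreover have "affine hull F \<subseteq> ?H"
    unfolding F_def by (intro hull_minimal affine_hyperplane) auto
  ultimately have hull: "affine hull F = ?H" by blast
  have "aff_dim F = int DIM('b) - 1"
    using hull aff_dim_affine_hull[of F] assms(4) by simp
  moreover have "aff_dim (closure ?C) = int DIM('b)"
  proof (rule aff_dim_eq_full[THEN iffD2])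
    have "aff_dim ?C = int DIM('b)"
      using open_strict_polyhedron[OF assms(1)] assms(2) by (rule aff_dim_open)
    then have "affine hull ?C = UNIV" by (simp add: aff_dim_eq_full)
    then show "affine hull closure ?C = UNIV"
      using hull_mono[OF closure_subset, of affine ?C] by blast
  qed
  moreover have "F \<noteq> {}" using hull z by auto
  ultimately have "F facet_of closure ?C" using face by (simp add: facet_of_def)
  then show ?thesis using hull by blast
qed

text \<open>A point beyond the hyperplane for one description can be scaled towards the origin until it lies on
the hyperplane, whereas a point before it for the other description never reaches the
hyperplane in this way.\<close>

lemma halfspaces_of_hyperplane:
  fixes a :: "'a::euclidean_space"
  assumes "{x. a \<bullet> x = b} = {x. a' \<bullet> x = b'}" "0 < b" "0 < b'"
  shows "{x. a \<bullet> x < b} = {x. a' \<bullet> x < b'}"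
proof -
  have "a' \<bullet> x < b'" if eq: "{x. a \<bullet> x = b} = {x. a' \<bullet> x = b'}" and b: "0 < b" "0 < b'"
    and x: "a \<bullet> x < b" for a a' x :: 'a and b b'
  proof (rule ccontr)
    assume "\<not> a' \<bullet> x < b'"
    then have ge: "a' \<bullet> x \<ge> b'" by simp
    define t where "t = b' / (a' \<bullet> x)"
    have t: "0 < t" "t \<le> 1" using ge b(2) by (auto simp: t_def)
    have "a' \<bullet> (t *\<^sub>R x) = b'" using ge b(2) by (simp add: t_def)
    then have "a \<bullet> (t *\<^sub>R x) = b" using eq by blast
    then have "t * (a \<bullet> x) = b" by simp
    moreover have "t * (a \<bullet> x) < b"
    proof (cases "a \<bullet> x \<le> 0")
      case True
      then have "t * (a \<bullet> x) \<le> 0" using t by (simp add: mult_nonneg_nonpos)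
      then show ?thesis using b by simp
    next
      case False
      then have "t * (a \<bullet> x) \<le> 1 * (a \<bullet> x)" using t by (intro mult_right_mono) auto
      then show ?thesis using x by simp
    qed
    ultimately show False by simp
  qed
  from this[OF assms] this[OF assms(1)[symmetric] assms(3,2)] show ?thesis by blast
qed

lemma same_side_iff:
  assumes "a \<noteq> 0" "0 < b"
  shows "same_side {x. a \<bullet> x = b} R \<longleftrightarrow> R \<subseteq> {x. a \<bullet> x < b}"
proof
  assume "same_side {x. a \<bullet> x = b} R"
  then obtain a' b' where "{x. a \<bullet> x = b} = {x. a' \<bullet> x = b'}" "0 < b'" "R \<subseteq> {x. a' \<bullet> x < b'}"
    by (auto simp: same_side_def)
  then show "R \<subseteq> {x. a \<bullet> x < b}" using halfspaces_of_hyperplane assms(2) by metis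
next
  assume "R \<subseteq> {x. a \<bullet> x < b}"
  then show "same_side {x. a \<bullet> x = b} R" using assms unfolding same_side_def by auto
qed

lemma opposite_sides_iff:
  assumes "a \<noteq> 0" "0 < b"
  shows "opposite_sides {x. a \<bullet> x = b} R \<longleftrightarrow> R \<subseteq> {x. a \<bullet> x > b}"
proof
  assume "opposite_sides {x. a \<bullet> x = b} R"
  then obtain a' b' where h: "{x. a \<bullet> x = b} = {x. a' \<bullet> x = b'}" "0 < b'" "R \<subseteq> {x. a' \<bullet> x > b'}"
    by (auto simp: opposite_sides_def)
  have "a \<bullet> x > b" if "x \<in> R" for x
  proof -
    have "a' \<bullet> x > b'" using h(3) that by auto
    then have "x \<notin> {x. a' \<bullet> x < b'}" "x \<notin> {x. a' \<bullet> x = b'}" by auto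
    then have "x \<notin> {x. a \<bullet> x < b}" "x \<notin> {x. a \<bullet> x = b}"
      using halfspaces_of_hyperplane[OF h(1) assms(2) h(2)] h(1) by auto
    then show ?thesis by auto
  qed
  then show "R \<subseteq> {x. a \<bullet> x > b}" by auto
next
  assume "R \<subseteq> {x. a \<bullet> x > b}"
  then show "opposite_sides {x. a \<bullet> x = b} R" using assms unfolding opposite_sides_def by auto
qed

section \<open>Prescribing which differences are below one\<close>

lemma exists_between:
  fixes L U :: "real set"
  assumes "finite L" "finite U" "\<And>l u. l \<in> L \<Longrightarrow> u \<in> U \<Longrightarrow> l < u"
  shows "\<exists>v. (\<forall>l\<in>L. l < v) \<and> (\<forall>u\<in>U. v < u)"
proof (cases "L = {} \<or> U = {}")
  case True
  then show ?thesis
  proof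
    assume "L = {}"
    have "Min (insert 0 U) - 1 < u" if "u \<in> U" for u
    proof -
      have "Min (insert 0 U) \<le> u" using assms(2) that by (intro Min_le) auto
      then show ?thesis by linarith
    qed
    then show ?thesis using \<open>L = {}\<close> by blast
  next
    assume "U = {}"
    have "l < Max (insert 0 L) + 1" if "l \<in> L" for l
    proof -
      have "l \<le> Max (insert 0 L)" using assms(1) that by (intro Max_ge) auto
      then show ?thesis by linarith
    qed
    then show ?thesis using \<open>U = {}\<close> by blast
  qed
next
  case False
  then have "Max L < Min U" using assms by simp
  then obtain v where "Max L < v" "v < Min U" using dense by blast
  then show ?thesis using assms(1,2) False by auto
qed

text \<open>The new first coordinate \<open>v\<close> must exceed all others, exceed those of far letters by more than one and
those of near letters by less than one. These finitely many bounds are compatible, because the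
letters near to \<open>p\<close> are near to each other and precede the far ones. For the induction, \<open>N\<close> may
contain descents; the restriction to ascents is made in \<open>shi_cell_nonempty\<close>.\<close>

lemma near_relation_realizable:
  assumes "distinct w"
    and "\<And>i j k l. (i, j) \<in> N \<Longrightarrow> (k, l) \<in> before w \<Longrightarrow> ((k, l), (i, j)) \<in> nested w \<Longrightarrow> (k, l) \<in> N"
  shows "\<exists>x::'a \<Rightarrow> real. \<forall>(i, j)\<in>before w. x j < x i \<and>
    ((i, j) \<in> N \<longrightarrow> x i - x j < 1) \<and> ((i, j) \<notin> N \<longrightarrow> x i - x j > 1)"
  using assms
proof (induction w)
  case Nil
  then show ?case by simp
next
  case (Cons p w)
  have dw: "distinct w" "p \<notin> set w" using Cons.prems(1) by auto
  have down: "(k, l) \<in> N" if "(i, j) \<in> N" "(k, l) \<in> before (p # w)"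
    "k = i \<or> (i, k) \<in> before (p # w)" "l = j \<or> (l, j) \<in> before (p # w)" for i j k l
  proof (cases "(k, l) = (i, j)")
    case False
    then show ?thesis using Cons.prems(2)[OF that(1,2)] that(3,4) by (auto simp: nested_def)
  qed (use that in auto)
  have dN: "(k, l) \<in> N" if "(i, j) \<in> N" "(k, l) \<in> before w" "((k, l), (i, j)) \<in> nested w" for i j k l
    using down[of i j k l] that by (auto simp: nested_def)
  have "\<exists>x::'a \<Rightarrow> real. \<forall>(i, j)\<in>before w. x j < x i \<and>
    ((i, j) \<in> N \<longrightarrow> x i - x j < 1) \<and> ((i, j) \<notin> N \<longrightarrow> x i - x j > 1)"
    by (rule Cons.IH[OF dw(1)]) (rule dN)
  then obtain x :: "'a \<Rightarrow> real" where x0: "\<forall>(i, j)\<in>before w. x j < x i \<and>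
    ((i, j) \<in> N \<longrightarrow> x i - x j < 1) \<and> ((i, j) \<notin> N \<longrightarrow> x i - x j > 1)"
    by blast
  then have x: "x j < x i" "(i, j) \<in> N \<Longrightarrow> x i - x j < 1" "(i, j) \<notin> N \<Longrightarrow> x i - x j > 1"
    if "(i, j) \<in> before w" for i j using that by auto
  \<comment> \<open>lower and upper bounds for the new coordinate\<close>
  define L where "L = x ` set w \<union> (\<lambda>j. x j + 1) ` {j \<in> set w. (p, j) \<notin> N}"
  define U where "U = (\<lambda>j. x j + 1) ` {j \<in> set w. (p, j) \<in> N}"
  have "l < u" if lu: "l \<in> L" "u \<in> U" for l u
  proof -
    obtain m where m: "m \<in> set w" "(p, m) \<in> N" "u = x m + 1" using lu(2) by (auto simp: U_def)
    from lu(1) consider j where "j \<in> set w" "l = x j" | j where "j \<in> set w" "(p, j) \<notin> N" "l = x j + 1"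
      by (auto simp: L_def)
    then show ?thesis
    proof cases
      case 1
      show ?thesis
      proof (cases "j = m")
        case False
        then consider "(j, m) \<in> before w" | "(m, j) \<in> before w" using before_total 1 m by metis
        then show ?thesis
        proof cases
          case a: 1
          have "(j, m) \<in> N" using down[OF m(2), of j m] a 1 by auto
          then show ?thesis using x(2)[OF a] 1 m by simp
        next
          case 2
          then show ?thesis using x(1)[OF 2] 1 m by simp
        qed
      qed (use 1 m in simp)
    next
      case 2
      then have "j \<noteq> m" using m by auto
      moreover have "(j, m) \<notin> before w"
        using down[OF m(2), of p j] 2 by auto
      ultimately have "(m, j) \<in> before w" using before_total 2 m by metis
      then show ?thesis using x(1) 2 m by simp
    qed
  qed
  moreover have "finite L" "finite U" by (auto simp: L_def U_def)
  ultimately obtain v where v: "\<forall>l\<in>L. l < v" "\<forall>u\<in>U. v < u" using exists_between by blast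
  have vj: "x j < v" "(p, j) \<in> N \<Longrightarrow> v - x j < 1" "(p, j) \<notin> N \<Longrightarrow> v - x j > 1" if "j \<in> set w" for j
  proof -
    show "x j < v" using v(1) that by (simp add: L_def)
    show "v - x j < 1" if "(p, j) \<in> N"
    proof -
      have "x j + 1 \<in> U" using that \<open>j \<in> set w\<close> by (simp add: U_def)
      then show ?thesis using v(2) by fastforce
    qed
    show "v - x j > 1" if "(p, j) \<notin> N"
    proof -
      have "x j + 1 \<in> L" using that \<open>j \<in> set w\<close> by (simp add: L_def)
      then show ?thesis using v(1) by fastforce
    qed
  qed
  have ne: "i \<noteq> p" "j \<noteq> p" if "(i, j) \<in> before w" for i j
    using that dw before_subset[of w] by auto
  have "\<forall>(i, j)\<in>before (p # w). (x(p := v)) j < (x(p := v)) i \<and>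
    ((i, j) \<in> N \<longrightarrow> (x(p := v)) i - (x(p := v)) j < 1) \<and>
    ((i, j) \<notin> N \<longrightarrow> (x(p := v)) i - (x(p := v)) j > 1)"
  proof clarify
    fix i j assume "(i, j) \<in> before (p # w)"
    then consider "i = p" "j \<in> set w" | "(i, j) \<in> before w" by auto
    then show "(x(p := v)) j < (x(p := v)) i \<and>
      ((i, j) \<in> N \<longrightarrow> (x(p := v)) i - (x(p := v)) j < 1) \<and>
      ((i, j) \<notin> N \<longrightarrow> (x(p := v)) i - (x(p := v)) j > 1)"
    proof cases
      case 1
      then have "j \<noteq> p" using dw by auto
      then show ?thesis using vj[OF 1(2)] 1 by simp
    next
      case 2
      then show ?thesis using ne[OF 2] x[OF 2] by simp
    qed
  qed
  then show ?case by blast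
qed

section \<open>The regions of the Shi arrangement\<close>

text \<open>The combinatorial names of the regions: the decreasing order of the coordinates, and the ascents
whose difference is below one.\<close>

definition shi_codes :: "('n::{finite,linorder} list \<times> ('n \<times> 'n) set) set" where
  "shi_codes = (SIGMA w:{w. distinct w \<and> set w = UNIV}. down_sets (ascents w) (nested w))"

text \<open>A triple \<open>(i, j, c)\<close> stands for the inequality \<open>x\<^sub>i - x\<^sub>j < c\<close>; lower bounds are written as upper
bounds of the opposite difference.\<close>

definition shi_constraints :: "'n::linorder list \<Rightarrow> ('n \<times> 'n) set \<Rightarrow> ('n \<times> 'n \<times> real) set" where
  "shi_constraints w N = {(j, i, 0) | i j. (i, j) \<in> before w} \<union> {(i, j, 1) | i j. (i, j) \<in> N} \<union>
     {(j, i, - 1) | i j. (i, j) \<in> ascents w - N}"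

definition diff_polyhedron :: "('n \<times> 'n \<times> real) set \<Rightarrow> (real ^ 'n::finite) set" where
  "diff_polyhedron K = strict_polyhedron K (\<lambda>(i, j, c). axis i 1 - axis j 1) (\<lambda>(i, j, c). c)"

abbreviation shi_cell :: "'n::{finite,linorder} list \<Rightarrow> ('n \<times> 'n) set \<Rightarrow> (real ^ 'n::{finite,linorder}) set" where
  "shi_cell w N \<equiv> diff_polyhedron (shi_constraints w N)"

definition diff_hyperplane :: "'n::finite \<Rightarrow> 'n \<Rightarrow> real \<Rightarrow> (real ^ 'n) set" where
  "diff_hyperplane i j c = {x. x $ i - x $ j = c}"

lemma inner_axis_diff: "(axis i 1 - axis j 1) \<bullet> (x :: real ^ 'n::finite) = x $ i - x $ j"
  by (simp add: inner_diff_left inner_axis')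

lemma axis_diff_nonzero: "i \<noteq> j \<Longrightarrow> axis i 1 - axis j 1 \<noteq> (0 :: real ^ 'n::finite)"
  by (simp add: axis_eq_axis)

lemma diff_hyperplane_inner:
  "diff_hyperplane i j c = {x. (axis i 1 - axis j 1) \<bullet> x = c}"
  by (simp add: diff_hyperplane_def inner_axis_diff)

lemma in_diff_polyhedron: "x \<in> diff_polyhedron K \<longleftrightarrow> (\<forall>(i, j, c)\<in>K. x $ i - x $ j < c)"
  by (force simp: diff_polyhedron_def strict_polyhedron_def inner_axis_diff)

lemma in_shi_cell:
  "x \<in> shi_cell w N \<longleftrightarrow> (\<forall>(i, j)\<in>before w. x $ j < x $ i) \<and> (\<forall>(i, j)\<in>N. x $ i - x $ j < 1) \<and>
     (\<forall>(i, j)\<in>ascents w - N. x $ i - x $ j > 1)"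
proof -
  have "(\<forall>(i, j, c)\<in>{(j, i, 0) | i j. (i, j) \<in> before w}. x $ i - x $ j < c) \<longleftrightarrow>
      (\<forall>(i, j)\<in>before w. x $ j < x $ i)"
    by (auto; force)
  moreover have "(\<forall>(i, j, c)\<in>{(i, j, 1) | i j. (i, j) \<in> N}. x $ i - x $ j < c) \<longleftrightarrow>
      (\<forall>(i, j)\<in>N. x $ i - x $ j < 1)"
    by (auto; force)
  moreover have "(\<forall>(i, j, c)\<in>{(j, i, - 1) | i j. (i, j) \<in> ascents w - N}. x $ i - x $ j < c) \<longleftrightarrow>
      (\<forall>(i, j)\<in>ascents w - N. x $ i - x $ j > 1)"
    by (auto; force)
  ultimately show ?thesis unfolding in_diff_polyhedron shi_constraints_def ball_Un by (simp only: conj_assoc)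
qed

text \<open>Any value may be given to the coordinates other than \<open>i\<close> and \<open>j\<close>, so \<open>k\<close> and \<open>l\<close> can only be
these two.\<close>

lemma diff_hyperplane_subset:
  assumes "diff_hyperplane i j c \<subseteq> diff_hyperplane k l d" "i \<noteq> j" "k \<noteq> l"
  shows "(k, l, d) = (i, j, c) \<or> (k, l, d) = (j, i, - c)"
proof -
  \<comment> \<open>points of the smaller hyperplane, with free choice of the coordinates other than \<open>i\<close> and \<open>j\<close>\<close>
  define p where "p = (\<lambda>s t. \<chi> m. if m = i then s + c else if m = j then s else t m)"
  have p: "p s t $ k - p s t $ l = d" for s t
  proof -
    have "p s t \<in> diff_hyperplane i j c" using assms(2) by (simp add: p_def diff_hyperplane_def)
    then show ?thesis using assms(1) by (auto simp: diff_hyperplane_def)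
  qed
  have k: "k = i \<or> k = j"
  proof (rule ccontr)
    assume "\<not> (k = i \<or> k = j)"
    then show False
      using p[of 0 "\<lambda>m. if m = k then 0 else 0"] p[of 0 "\<lambda>m. if m = k then 1 else 0"] assms(3)
      by (simp add: p_def split: if_splits)
  qed
  have l: "l = i \<or> l = j"
  proof (rule ccontr)
    assume "\<not> (l = i \<or> l = j)"
    then show False
      using p[of 0 "\<lambda>m. if m = l then 0 else 0"] p[of 0 "\<lambda>m. if m = l then 1 else 0"] assms(3)
      by (simp add: p_def split: if_splits)
  qed
  show ?thesis using k l p[of 0 "\<lambda>m. 0"] assms(2,3) by (auto simp: p_def)
qed

lemma finite_shi_constraints:
  fixes w :: "'n::{finite,linorder} list"
  shows "finite (shi_constraints w N)"
proof -
  have "shi_constraints w N \<subseteq> UNIV \<times> UNIV \<times> {0, 1, - 1}"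
    by (auto simp: shi_constraints_def)
  then show ?thesis by (rule finite_subset) auto
qed

text \<open>The down-closure \<open>M\<close> of \<open>N\<close> among all pairs of letters contains no ascents besides those in \<open>N\<close>.\<close>

lemma shi_cell_nonempty:
  assumes "(w, N) \<in> shi_codes"
  shows "shi_cell w N \<noteq> {}"
proof -
  have w: "distinct w" and N: "N \<in> down_sets (ascents w) (nested w)" using assms by (auto simp: shi_codes_def)
  \<comment> \<open>\<open>near_relation_realizable\<close> needs a relation closed under nesting of all pairs, descents included\<close>
  define M where "M = {a \<in> before w. \<exists>b\<in>N. a = b \<or> (a, b) \<in> nested w}"
  note tr = trans_nested[OF w, THEN transD]
  have "\<exists>x::'a \<Rightarrow> real. \<forall>(i, j)\<in>before w. x j < x i \<and>
    ((i, j) \<in> M \<longrightarrow> x i - x j < 1) \<and> ((i, j) \<notin> M \<longrightarrow> x i - x j > 1)"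
    by (rule near_relation_realizable[OF w]) (use tr in \<open>unfold M_def, blast\<close>)
  then obtain x :: "'a \<Rightarrow> real" where x: "\<forall>(i, j)\<in>before w. x j < x i \<and>
    ((i, j) \<in> M \<longrightarrow> x i - x j < 1) \<and> ((i, j) \<notin> M \<longrightarrow> x i - x j > 1)" by blast
  have asc: "ascents w \<subseteq> before w" by (auto simp: ascents_def)
  have N1: "N \<subseteq> M" "N \<subseteq> ascents w" using N asc by (auto simp: M_def down_sets_def)
  have N2: "ascents w - N \<subseteq> - M" using N asc by (auto simp: M_def down_sets_def)
  have "vec_lambda x \<in> shi_cell w N"
    unfolding in_shi_cell using x N1 N2 asc by fastforce
  then show ?thesis by blast
qed

lemma shi_constraints_nontrivial:
  assumes "distinct w" "N \<subseteq> ascents w" "(i, j, c) \<in> shi_constraints w N"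
  shows "i \<noteq> j"
  using assms before_irrefl[OF assms(1)] by (auto simp: shi_constraints_def ascents_def)

text \<open>Two cells whose down-sets differ in one ascent satisfy the same inequalities apart from those
placing the difference of that ascent below or above one. A segment between them crosses the hyperplane of this ascent, and by
convexity all the common inequalities hold at the crossing.\<close>

lemma crossing_point:
  assumes "distinct w" "N \<subseteq> ascents w" "(i, j) \<notin> N"
    "x \<in> shi_cell w (insert (i, j) N)" "y \<in> shi_cell w N" "(i, j) \<in> ascents w"
  obtains z where "z $ i - z $ j = 1"
    "\<And>k l c. (k, l, c) \<in> shi_constraints w N \<union> shi_constraints w (insert (i, j) N) \<Longrightarrow>
       (k, l, c) \<noteq> (i, j, 1) \<Longrightarrow> (k, l, c) \<noteq> (j, i, - 1) \<Longrightarrow> z $ k - z $ l < c"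
proof -
  define K where "K = (shi_constraints w N \<union> shi_constraints w (insert (i, j) N)) - {(i, j, 1), (j, i, - 1)}"
  have "K \<subseteq> shi_constraints w N" "K \<subseteq> shi_constraints w (insert (i, j) N)"
    by (auto simp: K_def shi_constraints_def)
  then have K: "x \<in> diff_polyhedron K" "y \<in> diff_polyhedron K"
    using assms(4,5) unfolding in_diff_polyhedron by blast+
  have xl: "x $ i - x $ j < 1" using assms(4) by (auto simp: in_shi_cell)
  have yl: "y $ i - y $ j > 1" using assms(3,5,6) by (auto simp: in_shi_cell)
  \<comment> \<open>the parameter at which the difference of the two coordinates, affine along the segment, equals one\<close>
  define t where "t = (1 - (x $ i - x $ j)) / ((y $ i - y $ j) - (x $ i - x $ j))"
  have t: "0 \<le> t" "t \<le> 1" using xl yl by (auto simp: t_def divide_simps)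
  define z where "z = (1 - t) *\<^sub>R x + t *\<^sub>R y"
  have "z $ i - z $ j = (x $ i - x $ j) + t * ((y $ i - y $ j) - (x $ i - x $ j))"
    by (simp add: z_def algebra_simps)
  also have "\<dots> = 1" using xl yl by (simp add: t_def)
  finally have "z $ i - z $ j = 1" .
  moreover have "z \<in> diff_polyhedron K"
    using K t unfolding z_def diff_polyhedron_def
    by (intro convexD[OF convex_strict_polyhedron]) auto
  then have "z $ k - z $ l < c" if "(k, l, c) \<in> K" for k l c
    using that by (auto simp: in_diff_polyhedron)
  ultimately show thesis by (intro that) (auto simp: K_def)
qed

lemma diff_hyperplane_swap: "diff_hyperplane j i (- c) = diff_hyperplane i j c"
  by (auto simp: diff_hyperplane_def)

lemma diff_hyperplane_in_shi:
  "i < j \<Longrightarrow> diff_hyperplane i j 1 \<in> shi_arrangement"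
  by (auto simp: shi_arrangement_def diff_hyperplane_def)

text \<open>Distinct constraints, up to reversing both sign and bound, have distinct hyperplanes, neither of
which contains the other; so \<open>facet_point\<close> makes all of them strict except those of the
wall itself.\<close>

lemma shi_wall_point:
  assumes "distinct w" "N \<subseteq> ascents w" "shi_cell w N \<noteq> {}" "i \<noteq> j"
    and wall: "is_wall S (shi_cell w N) (diff_hyperplane i j d)"
  obtains z where "z $ i - z $ j = d"
    "\<And>k l c. (k, l, c) \<in> shi_constraints w N \<Longrightarrow>
       (k, l, c) \<noteq> (i, j, d) \<Longrightarrow> (k, l, c) \<noteq> (j, i, - d) \<Longrightarrow> z $ k - z $ l < c"
proof -
  obtain F where F: "F facet_of closure (shi_cell w N)" "affine hull F = diff_hyperplane i j d"
    using wall by (auto simp: is_wall_def)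
  from facet_point[OF assms(3)[unfolded diff_polyhedron_def] F(1)[unfolded diff_polyhedron_def]]
  obtain z where z: "z \<in> diff_hyperplane i j d" "\<And>k. k \<in> shi_constraints w N \<Longrightarrow>
    \<not> diff_hyperplane i j d \<subseteq> {x. (case k of (i, j, c) \<Rightarrow> axis i 1 - axis j 1) \<bullet> x = (case k of (i, j, c) \<Rightarrow> c)} \<Longrightarrow>
    (case k of (i, j, c) \<Rightarrow> axis i 1 - axis j 1) \<bullet> z < (case k of (i, j, c) \<Rightarrow> c)"
    unfolding F(2) by blast
  show thesis
  proof
    show "z $ i - z $ j = d" using z(1) by (simp add: diff_hyperplane_def)
    fix k l c
    assume k: "(k, l, c) \<in> shi_constraints w N" "(k, l, c) \<noteq> (i, j, d)" "(k, l, c) \<noteq> (j, i, - d)"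
    have "\<not> diff_hyperplane i j d \<subseteq> diff_hyperplane k l c"
      using diff_hyperplane_subset[of i j d k l c] k assms(4)
        shi_constraints_nontrivial[OF assms(1,2) k(1)] by blast
    then show "z $ k - z $ l < c"
      using z(2)[OF k(1)] by (simp add: diff_hyperplane_inner[of k] inner_axis_diff)
  qed
qed

lemma shi_wall_of_point:
  assumes "distinct w" "N \<subseteq> ascents w" "shi_cell w N \<noteq> {}"
    and "(i, j, d) \<in> shi_constraints w N" "z $ i - z $ j = d"
    and "\<And>k l c. (k, l, c) \<in> shi_constraints w N \<Longrightarrow> (k, l, c) \<noteq> (i, j, d) \<Longrightarrow> z $ k - z $ l < c"
    and "diff_hyperplane i j d \<in> S"
  shows "is_wall S (shi_cell w N) (diff_hyperplane i j d)"
proof -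
  have "i \<noteq> j" using shi_constraints_nontrivial[OF assms(1,2,4)] .
  let ?a = "\<lambda>(i, j, c). axis i 1 - axis j 1 :: real ^ 'a::{finite,linorder}" and ?b = "\<lambda>(i, j, c). c :: real"
  have "\<exists>F. F facet_of closure (strict_polyhedron (shi_constraints w N) ?a ?b) \<and>
    affine hull F = {x. ?a (i, j, d) \<bullet> x = ?b (i, j, d)}"
  proof (rule facet_of_point)
    show "finite (shi_constraints w N)" by (rule finite_shi_constraints)
    show "strict_polyhedron (shi_constraints w N) ?a ?b \<noteq> {}"
      using assms(3) by (simp add: diff_polyhedron_def)
    show "?a (i, j, d) \<noteq> 0" unfolding prod.case using \<open>i \<noteq> j\<close> by (rule axis_diff_nonzero)
    show "?a (i, j, d) \<bullet> z = ?b (i, j, d)" using assms(5) by (simp add: inner_axis_diff)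
    show "?a k \<bullet> z < ?b k" if "k \<in> shi_constraints w N" "k \<noteq> (i, j, d)" for k
      using assms(6) that by (cases k) (simp only: prod.case inner_axis_diff)
  qed (rule assms(4))
  then show ?thesis using assms(7)
    by (simp add: is_wall_def diff_hyperplane_inner diff_polyhedron_def)
qed

lemma shi_codesD:
  assumes "(w, N) \<in> shi_codes"
  shows "distinct w" "set w = UNIV" "N \<subseteq> ascents w" "N \<in> down_sets (ascents w) (nested w)"
  using assms by (auto simp: shi_codes_def down_sets_def)

lemma sorted_wrt_iff_before: "sorted_wrt P w \<longleftrightarrow> (\<forall>(i, j)\<in>before w. P i j)"
  by (induction w) auto

lemma shi_cells_disjoint:
  fixes x :: "real ^ 'n::{finite,linorder}"
  assumes "(w, N) \<in> shi_codes" "(v, M) \<in> shi_codes" "x \<in> shi_cell w N" "x \<in> shi_cell v M"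
  shows "(w, N) = (v, M)"
proof -
  note w = shi_codesD[OF assms(1)] and v = shi_codesD[OF assms(2)]
  have inj: "inj_on (($) x) UNIV"
  proof (rule inj_onI)
    fix i j assume "x $ i = x $ j"
    then show "i = j" using before_total[of i w j] w(2) assms(3) by (fastforce simp: in_shi_cell)
  qed
  have srt: "sorted_wrt (<) (map (\<lambda>i. - x $ i) u)" if "\<forall>(i, j)\<in>before u. x $ j < x $ i" for u
    unfolding sorted_wrt_map unfolding sorted_wrt_iff_before using that by simp
  have "map (\<lambda>i. - x $ i) w = map (\<lambda>i. - x $ i) v"
    using assms(3,4) w(2) v(2)
    by (intro strict_sorted_equal srt) (auto simp: in_shi_cell)
  then have wv: "w = v"
    by (rule map_inj_on) (use inj in \<open>auto simp: inj_on_def\<close>)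
  have "N = {(i, j) \<in> ascents w. x $ i - x $ j < 1}" if xN: "x \<in> shi_cell w N" and Nw: "N \<subseteq> ascents w" for w N
  proof -
    have "(i, j) \<in> N \<longleftrightarrow> x $ i - x $ j < 1" if "(i, j) \<in> ascents w" for i j
    proof (cases "(i, j) \<in> N")
      case True
      then have "x $ i - x $ j < 1" using xN by (auto simp: in_shi_cell)
      then show ?thesis using True by simp
    next
      case False
      then have "x $ i - x $ j > 1" using xN that by (auto simp: in_shi_cell)
      then show ?thesis using False by simp
    qed
    then show ?thesis using Nw by auto
  qed
  then have "N = {(i, j) \<in> ascents w. x $ i - x $ j < 1}" "M = {(i, j) \<in> ascents v. x $ i - x $ j < 1}"
    using assms(3,4) w(3) v(3) by blast+
  then show ?thesis using wv by simp
qed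

text \<open>For a point off the arrangement, \<open>w\<close> sorts the indices by decreasing coordinate, and \<open>N\<close> collects
the ascents with difference below one.\<close>

lemma Union_shi_cells:
  "(\<Union>(w, N)\<in>shi_codes. shi_cell w N) = UNIV - \<Union>(shi_arrangement :: (real ^ 'n::{finite,linorder}) set set)"
proof (intro equalityI subsetI)
  fix x :: "real ^ 'n::{finite,linorder}"
  assume "x \<in> (\<Union>(w, N)\<in>shi_codes. shi_cell w N)"
  then obtain w N where code: "(w, N) \<in> shi_codes" and x: "x \<in> shi_cell w N" by auto
  note w = shi_codesD[OF code]
  have "x $ i - x $ j \<noteq> 0 \<and> x $ i - x $ j \<noteq> 1" if ij: "i < j" for i j
  proof -
    consider "(i, j) \<in> before w" | "(j, i) \<in> before w"
      using before_total[of i w j] w(2) ij by auto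
    then show ?thesis
    proof cases
      case 1
      then have "(i, j) \<in> ascents w" using ij by (simp add: ascents_def)
      then show ?thesis using x 1 by (cases "(i, j) \<in> N") (force simp: in_shi_cell)+
    next
      case 2
      then show ?thesis using x by (force simp: in_shi_cell)
    qed
  qed
  then show "x \<in> UNIV - \<Union>shi_arrangement" by (auto simp: shi_arrangement_def)
next
  fix x :: "real ^ 'n::{finite,linorder}"
  assume "x \<in> UNIV - \<Union>shi_arrangement"
  then have x: "x $ i - x $ j \<noteq> 0" "x $ i - x $ j \<noteq> 1" if "i < j" for i j
    using that by (auto simp: shi_arrangement_def)
  have inj: "inj (\<lambda>i. - x $ i)"
  proof (rule injI)
    fix i j assume "- x $ i = - x $ j"
    then show "i = j" using x(1)[of i j] x(1)[of j i] by (cases i j rule: linorder_cases) auto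
  qed
  define w where "w = sort_key (\<lambda>i. - x $ i) (sorted_list_of_set UNIV)"
  have w: "distinct w" "set w = UNIV" by (simp_all add: w_def)
  have "sorted_wrt (<) (map (\<lambda>i. - x $ i) w)"
    unfolding strict_sorted_iff using w(1) inj
    by (auto simp: w_def distinct_map intro: inj_on_subset)
  then have bw: "\<forall>(i, j)\<in>before w. x $ j < x $ i"
    unfolding sorted_wrt_map unfolding sorted_wrt_iff_before by simp
  define N where "N = {(i, j) \<in> ascents w. x $ i - x $ j < 1}"
  have "N \<in> down_sets (ascents w) (nested w)"
    unfolding down_sets_def
  proof (intro CollectI conjI ballI impI)
    show "N \<subseteq> ascents w" by (auto simp: N_def)
    fix b a assume "b \<in> N" "a \<in> ascents w" "(a, b) \<in> nested w"
    moreover obtain i j k l where "a = (i, j)" "b = (k, l)" by (metis surj_pair)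
    ultimately have ab: "(i, j) \<in> ascents w" "x $ k - x $ l < 1" "k = i \<or> (k, i) \<in> before w"
      "j = l \<or> (j, l) \<in> before w" "a = (i, j)" by (auto simp: N_def nested_def)
    then have "x $ i \<le> x $ k" "x $ l \<le> x $ j" using bw by auto
    then show "a \<in> N" using ab by (simp add: N_def)
  qed
  then have "(w, N) \<in> shi_codes" using w by (simp add: shi_codes_def)
  moreover have "x \<in> shi_cell w N"
    unfolding in_shi_cell
  proof (intro conjI bw)
    show "\<forall>(i, j)\<in>N. x $ i - x $ j < 1" by (auto simp: N_def)
    show "\<forall>(i, j)\<in>ascents w - N. x $ i - x $ j > 1"
    proof clarify
      fix i j assume "(i, j) \<in> ascents w" "(i, j) \<notin> N"
      then show "x $ i - x $ j > 1" using x(2)[of i j] by (auto simp: N_def ascents_def)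
    qed
  qed
  ultimately show "x \<in> (\<Union>(w, N)\<in>shi_codes. shi_cell w N)" by blast
qed

lemma inj_on_shi_cell: "inj_on (\<lambda>(w, N). shi_cell w N) shi_codes"
proof (rule inj_onI, clarify)
  fix w v :: "'a list" and N M
  assume *: "(w, N) \<in> shi_codes" "(v, M) \<in> shi_codes" "shi_cell w N = shi_cell v M"
  then obtain x where "x \<in> shi_cell w N" using shi_cell_nonempty by blast
  then show "w = v \<and> N = M" using shi_cells_disjoint * by blast
qed

lemma regions_shi: "regions shi_arrangement = (\<lambda>(w, N). shi_cell w N) ` shi_codes"
  unfolding regions_def
proof (rule components_open_unique)
  show "pairwise disjnt ((\<lambda>(w, N). shi_cell w N) ` shi_codes)"
    using shi_cells_disjoint unfolding pairwise_def disjnt_def by fastforce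
  show "\<Union>((\<lambda>(w, N). shi_cell w N) ` shi_codes) = UNIV - \<Union>shi_arrangement"
    by (rule Union_shi_cells)
  fix X assume "X \<in> (\<lambda>(w, N). shi_cell w N) ` shi_codes"
  then obtain w N where X: "(w, N) \<in> shi_codes" "X = shi_cell w N" by auto
  then show "open X \<and> connected X \<and> X \<noteq> {}"
    using open_strict_polyhedron[OF finite_shi_constraints]
      convex_connected[OF convex_strict_polyhedron] shi_cell_nonempty[OF X(1)]
    unfolding diff_polyhedron_def by blast
qed

section \<open>Ceilings and floors\<close>

text \<open>If \<open>j\<close> came before \<open>i\<close>, then the coordinates would satisfy \<open>z\<^sub>i < z\<^sub>j\<close> at the point of the wall,
where their difference is one.\<close>

lemma shi_wall_is_ascent:
  fixes w :: "'n::{finite,linorder} list"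
  assumes code: "(w, N) \<in> shi_codes" and "i < j"
    and wall: "is_wall S (shi_cell w N) (diff_hyperplane i j 1)"
  obtains z :: "real ^ 'n::{finite,linorder}" where "(i, j) \<in> ascents w" "z $ i - z $ j = 1"
    "\<And>k l. k = l \<or> (k, l) \<in> before w \<Longrightarrow> z $ l \<le> z $ k"
    "\<And>k l. (k, l) \<in> N \<Longrightarrow> (k, l) \<noteq> (i, j) \<Longrightarrow> z $ k - z $ l < 1"
    "\<And>k l. (k, l) \<in> ascents w - N \<Longrightarrow> (k, l) \<noteq> (i, j) \<Longrightarrow> z $ k - z $ l > 1"
proof -
  note w = shi_codesD[OF code]
  have ij: "i \<noteq> j" using assms(2) by simp
  obtain z :: "real ^ 'n::{finite,linorder}" where z: "z $ i - z $ j = 1"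
    "\<And>k l c. (k, l, c) \<in> shi_constraints w N \<Longrightarrow>
       (k, l, c) \<noteq> (i, j, 1) \<Longrightarrow> (k, l, c) \<noteq> (j, i, - 1) \<Longrightarrow> z $ k - z $ l < c"
    using shi_wall_point[OF w(1,3) shi_cell_nonempty[OF code] ij wall] by blast
  have bz: "z $ l < z $ k" if "(k, l) \<in> before w" for k l
    using z(2)[of l k 0] that by (simp add: shi_constraints_def)
  then have "(j, i) \<notin> before w" using z(1) by fastforce
  moreover have "(i, j) \<in> before w \<or> (j, i) \<in> before w"
    using before_total[of i w j] w(2) ij by simp
  ultimately have "(i, j) \<in> before w" by blast
  show thesis
  proof
    show "(i, j) \<in> ascents w" using \<open>(i, j) \<in> before w\<close> assms(2) by (simp add: ascents_def)
    show "z $ l \<le> z $ k" if "k = l \<or> (k, l) \<in> before w" for k l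
      using that bz[of k l] by (elim disjE) simp_all
    show "z $ k - z $ l < 1" if "(k, l) \<in> N" "(k, l) \<noteq> (i, j)" for k l
      using z(2)[of k l 1] that by (auto simp: shi_constraints_def)
    show "z $ k - z $ l > 1" if "(k, l) \<in> ascents w - N" "(k, l) \<noteq> (i, j)" for k l
      using z(2)[of l k "- 1"] that by (auto simp: shi_constraints_def)
  qed (rule z(1))
qed

text \<open>At a point in general position on the wall \<open>x\<^sub>i - x\<^sub>j = 1\<close>, an arc around \<open>(i, j)\<close> has a difference of
at least one and so cannot belong to \<open>N\<close>. Conversely, removing a maximal element of \<open>N\<close>
leaves a down-set, and the segment to its cell meets the wall.\<close>

lemma ceiling_iff_maximal:
  fixes w :: "'n::{finite,linorder} list"
  assumes code: "(w, N) \<in> shi_codes" and ij: "i < j"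
  shows "is_wall shi_arrangement (shi_cell w N) (diff_hyperplane i j 1) \<and>
      shi_cell w N \<subseteq> {x. x $ i - x $ j < 1} \<longleftrightarrow> (i, j) \<in> maximal (nested w) N"
proof (intro iffI; (elim conjE)?)
  note w = shi_codesD[OF code]
  assume wall: "is_wall shi_arrangement (shi_cell w N) (diff_hyperplane i j 1)"
    and low: "shi_cell w N \<subseteq> {x. x $ i - x $ j < 1}"
  obtain z :: "real ^ 'n::{finite,linorder}" where z: "(i, j) \<in> ascents w" "z $ i - z $ j = 1"
    "\<And>k l. k = l \<or> (k, l) \<in> before w \<Longrightarrow> z $ l \<le> z $ k"
    "\<And>k l. (k, l) \<in> N \<Longrightarrow> (k, l) \<noteq> (i, j) \<Longrightarrow> z $ k - z $ l < 1"
    using shi_wall_is_ascent[OF code ij wall] by metis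
  obtain x where x: "x \<in> shi_cell w N" using shi_cell_nonempty[OF code] by blast
  have "(i, j) \<in> N"
  proof (rule ccontr)
    assume "(i, j) \<notin> N"
    then have "x $ i - x $ j > 1" using x z(1) by (auto simp: in_shi_cell)
    then show False using low x by force
  qed
  moreover have "((i, j), (k, l)) \<notin> nested w" if "(k, l) \<in> N" for k l
  proof
    assume *: "((i, j), (k, l)) \<in> nested w"
    then have "z $ i \<le> z $ k" "z $ l \<le> z $ j" "(k, l) \<noteq> (i, j)"
      using z(3) by (auto simp: nested_def)
    then show False using z(2) z(4)[of k l] that by simp
  qed
  ultimately show "(i, j) \<in> maximal (nested w) N" by (auto simp: maximal_def)
next
  note w = shi_codesD[OF code]
  assume max: "(i, j) \<in> maximal (nested w) N"
  then have N: "(i, j) \<in> N" by (simp add: maximal_def)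
  define N' where "N' = N - {(i, j)}"
  have ins: "N = insert (i, j) N'" using N by (auto simp: N'_def)
  have code': "(w, N') \<in> shi_codes"
    using max w by (auto simp: shi_codes_def down_sets_def N'_def maximal_def)
  obtain x where x: "x \<in> shi_cell w N" using shi_cell_nonempty[OF code] by blast
  obtain y where y: "y \<in> shi_cell w N'" using shi_cell_nonempty[OF code'] by blast
  have ij': "(i, j) \<notin> N'" "(i, j) \<in> ascents w" using N w(3) by (auto simp: N'_def)
  obtain z :: "real ^ 'n::{finite,linorder}" where z: "z $ i - z $ j = 1"
    "\<And>k l c. (k, l, c) \<in> shi_constraints w N \<Longrightarrow>
       (k, l, c) \<noteq> (i, j, 1) \<Longrightarrow> (k, l, c) \<noteq> (j, i, - 1) \<Longrightarrow> z $ k - z $ l < c"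
    using crossing_point[OF w(1) shi_codesD(3)[OF code'] ij'(1) x[unfolded ins] y ij'(2)]
    unfolding ins[symmetric] by (metis UnCI)
  have no: "(j, i, - 1) \<notin> shi_constraints w N" using N by (auto simp: shi_constraints_def)
  have "is_wall shi_arrangement (shi_cell w N) (diff_hyperplane i j 1)"
  proof (rule shi_wall_of_point[where z = z])
    show "(i, j, 1) \<in> shi_constraints w N" using N by (auto simp: shi_constraints_def)
    show "z $ k - z $ l < c" if "(k, l, c) \<in> shi_constraints w N" "(k, l, c) \<noteq> (i, j, 1)" for k l c
      using z(2)[OF that] that no by metis
    show "diff_hyperplane i j 1 \<in> shi_arrangement" using ij by (rule diff_hyperplane_in_shi)
  qed (use w x z(1) in auto)
  moreover have "shi_cell w N \<subseteq> {x. x $ i - x $ j < 1}" using N by (auto simp: in_shi_cell)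
  ultimately show "is_wall shi_arrangement (shi_cell w N) (diff_hyperplane i j 1) \<and>
      shi_cell w N \<subseteq> {x. x $ i - x $ j < 1}" by blast
qed

text \<open>Dual to \<open>ceiling_iff_maximal\<close>: an arc inside \<open>(i, j)\<close> has a difference of at most one on the wall,
and adding a minimal missing ascent to \<open>N\<close> leaves a down-set.\<close>

lemma floor_iff_minimal:
  fixes w :: "'n::{finite,linorder} list"
  assumes code: "(w, N) \<in> shi_codes" and ij: "i < j"
  shows "is_wall shi_arrangement (shi_cell w N) (diff_hyperplane i j 1) \<and>
      shi_cell w N \<subseteq> {x. x $ i - x $ j > 1} \<longleftrightarrow>
      (i, j) \<in> maximal ((nested w)\<inverse>) (ascents w - N)"
proof (intro iffI; (elim conjE)?)
  note w = shi_codesD[OF code]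
  assume wall: "is_wall shi_arrangement (shi_cell w N) (diff_hyperplane i j 1)"
    and high: "shi_cell w N \<subseteq> {x. x $ i - x $ j > 1}"
  obtain z :: "real ^ 'n::{finite,linorder}" where z: "(i, j) \<in> ascents w" "z $ i - z $ j = 1"
    "\<And>k l. k = l \<or> (k, l) \<in> before w \<Longrightarrow> z $ l \<le> z $ k"
    "\<And>k l. (k, l) \<in> ascents w - N \<Longrightarrow> (k, l) \<noteq> (i, j) \<Longrightarrow> z $ k - z $ l > 1"
    using shi_wall_is_ascent[OF code ij wall] by metis
  obtain x where x: "x \<in> shi_cell w N" using shi_cell_nonempty[OF code] by blast
  have "(i, j) \<notin> N"
  proof
    assume "(i, j) \<in> N"
    then have "x $ i - x $ j < 1" using x by (auto simp: in_shi_cell)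
    then show False using high x by force
  qed
  moreover have "((k, l), (i, j)) \<notin> nested w" if "(k, l) \<in> ascents w - N" for k l
  proof
    assume *: "((k, l), (i, j)) \<in> nested w"
    then have "z $ k \<le> z $ i" "z $ j \<le> z $ l" "(k, l) \<noteq> (i, j)"
      using z(3) by (auto simp: nested_def)
    then show False using z(2) z(4)[of k l] that by simp
  qed
  ultimately show "(i, j) \<in> maximal ((nested w)\<inverse>) (ascents w - N)"
    using z(1) by (auto simp: maximal_def)
next
  note w = shi_codesD[OF code]
  assume min: "(i, j) \<in> maximal ((nested w)\<inverse>) (ascents w - N)"
  then have ij': "(i, j) \<notin> N" "(i, j) \<in> ascents w" by (simp_all add: maximal_def)
  have code': "(w, insert (i, j) N) \<in> shi_codes"
    using min w by (auto simp: shi_codes_def down_sets_def maximal_def)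
  obtain x where x: "x \<in> shi_cell w (insert (i, j) N)" using shi_cell_nonempty[OF code'] by blast
  obtain y where y: "y \<in> shi_cell w N" using shi_cell_nonempty[OF code] by blast
  obtain z :: "real ^ 'n::{finite,linorder}" where z: "z $ i - z $ j = 1"
    "\<And>k l c. (k, l, c) \<in> shi_constraints w N \<Longrightarrow>
       (k, l, c) \<noteq> (i, j, 1) \<Longrightarrow> (k, l, c) \<noteq> (j, i, - 1) \<Longrightarrow> z $ k - z $ l < c"
    using crossing_point[OF w(1,3) ij'(1) x y ij'(2)] by (metis UnCI)
  have no: "(i, j, 1) \<notin> shi_constraints w N" using ij' by (auto simp: shi_constraints_def)
  have "is_wall shi_arrangement (shi_cell w N) (diff_hyperplane j i (- 1))"
  proof (rule shi_wall_of_point[where z = z])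
    show "(j, i, - 1) \<in> shi_constraints w N" using ij' by (auto simp: shi_constraints_def)
    show "z $ k - z $ l < c" if "(k, l, c) \<in> shi_constraints w N" "(k, l, c) \<noteq> (j, i, - 1)" for k l c
      using z(2)[OF that(1)] that no by metis
    show "diff_hyperplane j i (- 1) \<in> shi_arrangement"
      using diff_hyperplane_in_shi[OF ij] diff_hyperplane_swap[of j i 1] by simp
  qed (use w y z(1) in auto)
  moreover have "shi_cell w N \<subseteq> {x. x $ i - x $ j > 1}"
  proof
    fix x assume "x \<in> shi_cell w N"
    moreover have "(i, j) \<in> ascents w - N" using ij' by blast
    ultimately show "x \<in> {x. x $ i - x $ j > 1}" unfolding in_shi_cell by blast
  qed
  ultimately show "is_wall shi_arrangement (shi_cell w N) (diff_hyperplane i j 1) \<and>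
      shi_cell w N \<subseteq> {x. x $ i - x $ j > 1}" using diff_hyperplane_swap[of j i 1] by simp
qed

lemma shi_hyperplane_off_origin:
  "H \<in> shi_arrangement \<and> 0 \<notin> H \<longleftrightarrow> (\<exists>i j. i < j \<and> H = diff_hyperplane i j 1)"
  by (auto simp: shi_arrangement_def diff_hyperplane_def)

lemma inj_on_diff_hyperplane:
  "inj_on (\<lambda>(i, j). diff_hyperplane i j 1) ({(i, j). i < j} :: ('n::{finite,linorder} \<times> 'n) set)"
proof (rule inj_onI, clarify)
  fix i j k l :: 'n
  assume "i < j" "k < l" "diff_hyperplane i j 1 = diff_hyperplane k l 1"
  then show "i = k \<and> j = l" using diff_hyperplane_subset[of i j 1 k l 1] by auto
qed

lemma card_ceilings:
  fixes w :: "'n::{finite,linorder} list"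
  assumes code: "(w, N) \<in> shi_codes"
  shows "card (ceilings shi_arrangement (shi_cell w N)) = card (maximal (nested w) N)"
proof -
  let ?M = "maximal (nested w) N"
  have M: "?M \<subseteq> {(i, j). i < j}"
    using shi_codesD[OF code] by (auto simp: maximal_def ascents_def)
  have "ceilings shi_arrangement (shi_cell w N) =
    {H. \<exists>i j. i < j \<and> H = diff_hyperplane i j 1 \<and> is_wall shi_arrangement (shi_cell w N) H \<and>
      same_side H (shi_cell w N)}"
    unfolding ceilings_def using shi_hyperplane_off_origin by (metis (no_types) is_wall_def)
  also have "\<dots> = {H. \<exists>i j. i < j \<and> H = diff_hyperplane i j 1 \<and> (i, j) \<in> ?M}"
  proof -
    have "same_side (diff_hyperplane i j 1) (shi_cell w N) \<longleftrightarrow>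
      shi_cell w N \<subseteq> {x. x $ i - x $ j < 1}" if "i < j" for i j
      unfolding diff_hyperplane_inner
      using same_side_iff[OF axis_diff_nonzero[OF less_imp_neq[OF that]], of 1]
      by (simp add: inner_axis_diff)
    note eq = this ceiling_iff_maximal[OF code]
    show ?thesis
      by (intro Collect_cong ex_cong1 conj_cong refl) (simp add: eq(1) eq(2)[symmetric])
  qed
  also have "\<dots> = (\<lambda>(i, j). diff_hyperplane i j 1) ` ?M" using M by force
  finally show ?thesis using inj_on_subset[OF inj_on_diff_hyperplane M] by (simp add: card_image)
qed

lemma card_floors:
  fixes w :: "'n::{finite,linorder} list"
  assumes code: "(w, N) \<in> shi_codes"
  shows "card (floors shi_arrangement (shi_cell w N)) =
    card (maximal ((nested w)\<inverse>) (ascents w - N))"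
proof -
  let ?M = "maximal ((nested w)\<inverse>) (ascents w - N)"
  have M: "?M \<subseteq> {(i, j). i < j}" by (auto simp: maximal_def ascents_def)
  have "floors shi_arrangement (shi_cell w N) =
    {H. \<exists>i j. i < j \<and> H = diff_hyperplane i j 1 \<and> is_wall shi_arrangement (shi_cell w N) H \<and>
      opposite_sides H (shi_cell w N)}"
    unfolding floors_def using shi_hyperplane_off_origin by (metis (no_types) is_wall_def)
  also have "\<dots> = {H. \<exists>i j. i < j \<and> H = diff_hyperplane i j 1 \<and> (i, j) \<in> ?M}"
  proof -
    have "opposite_sides (diff_hyperplane i j 1) (shi_cell w N) \<longleftrightarrow>
      shi_cell w N \<subseteq> {x. x $ i - x $ j > 1}" if "i < j" for i j
      unfolding diff_hyperplane_inner
      using opposite_sides_iff[OF axis_diff_nonzero[OF less_imp_neq[OF that]], of 1]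
      by (simp add: inner_axis_diff)
    note eq = this floor_iff_minimal[OF code]
    show ?thesis
      by (intro Collect_cong ex_cong1 conj_cong refl) (simp add: eq(1) eq(2)[symmetric])
  qed
  also have "\<dots> = (\<lambda>(i, j). diff_hyperplane i j 1) ` ?M" using M by force
  finally show ?thesis using inj_on_subset[OF inj_on_diff_hyperplane M] by (simp add: card_image)
qed

text \<open>The common index set to which the ceilings and the floors of the regions are both reduced.\<close>

definition arc_diagrams :: "('n::{finite,linorder} list \<times> ('n \<times> 'n) set) set" where
  "arc_diagrams = (SIGMA w:{w. distinct w \<and> set w = UNIV}. antichains (ascents w) (nested w))"

lemma bij_betw_Sigma_fibrewise:
  assumes "\<And>x. x \<in> X \<Longrightarrow> bij_betw (f x) (B x) (C x)"
  shows "bij_betw (\<lambda>(x, b). (x, f x b)) (Sigma X B) (Sigma X C)"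
  unfolding bij_betw_def
proof
  show "inj_on (\<lambda>(x, b). (x, f x b)) (Sigma X B)"
    using bij_betw_imp_inj_on[OF assms] by (auto intro!: inj_onI dest: inj_onD)
  have "f x ` B x = C x" if "x \<in> X" for x using bij_betw_imp_surj_on[OF assms[OF that]] .
  then show "(\<lambda>(x, b). (x, f x b)) ` Sigma X B = Sigma X C" by force
qed

lemma sum_regions_ceilings:
  "(\<Sum>R\<in>regions (shi_arrangement :: (real ^ 'n::{finite,linorder}) set set). g (card (ceilings shi_arrangement R))) =
   (\<Sum>(w, A)\<in>(arc_diagrams :: ('n list \<times> ('n \<times> 'n) set) set). g (card A))"
proof -
  have bij: "bij_betw (\<lambda>(w, N). (w, maximal (nested w) N)) (shi_codes :: ('n list \<times> ('n \<times> 'n) set) set) arc_diagrams"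
    unfolding shi_codes_def arc_diagrams_def
    by (intro bij_betw_Sigma_fibrewise bij_betw_maximal finite_ascents trans_nested irrefl_nested) simp
  have "(\<Sum>R\<in>regions (shi_arrangement :: (real ^ 'n::{finite,linorder}) set set). g (card (ceilings shi_arrangement R))) =
    (\<Sum>(w, N)\<in>(shi_codes :: ('n list \<times> ('n \<times> 'n) set) set). g (card (ceilings shi_arrangement (shi_cell w N))))"
    unfolding regions_shi by (subst sum.reindex[OF inj_on_shi_cell]) (simp add: case_prod_unfold)
  also have "\<dots> = (\<Sum>(w, N)\<in>(shi_codes :: ('n list \<times> ('n \<times> 'n) set) set). g (card (maximal (nested w) N)))"
    by (intro sum.cong refl) (auto simp: card_ceilings)
  also have "\<dots> = (\<Sum>(w, A)\<in>(arc_diagrams :: ('n list \<times> ('n \<times> 'n) set) set). g (card A))"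
    by (subst sum.reindex_bij_betw[OF bij, symmetric]) (simp add: case_prod_unfold)
  finally show ?thesis .
qed

lemma sum_regions_floors:
  "(\<Sum>R\<in>regions (shi_arrangement :: (real ^ 'n::{finite,linorder}) set set). g (card (floors shi_arrangement R))) =
   (\<Sum>(w, A)\<in>(arc_diagrams :: ('n list \<times> ('n \<times> 'n) set) set). g (card A))"
proof -
  have bij: "bij_betw (\<lambda>(w, N). (w, maximal ((nested w)\<inverse>) (ascents w - N)))
    (shi_codes :: ('n list \<times> ('n \<times> 'n) set) set) arc_diagrams"
    unfolding shi_codes_def arc_diagrams_def
    by (intro bij_betw_Sigma_fibrewise bij_betw_minimal_complement finite_ascents trans_nested irrefl_nested) simp
  have "(\<Sum>R\<in>regions (shi_arrangement :: (real ^ 'n::{finite,linorder}) set set). g (card (floors shi_arrangement R))) =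
    (\<Sum>(w, N)\<in>(shi_codes :: ('n list \<times> ('n \<times> 'n) set) set). g (card (floors shi_arrangement (shi_cell w N))))"
    unfolding regions_shi by (subst sum.reindex[OF inj_on_shi_cell]) (simp add: case_prod_unfold)
  also have "\<dots> = (\<Sum>(w, N)\<in>(shi_codes :: ('n list \<times> ('n \<times> 'n) set) set).
      g (card (maximal ((nested w)\<inverse>) (ascents w - N))))"
    by (intro sum.cong refl) (auto simp: card_floors)
  also have "\<dots> = (\<Sum>(w, A)\<in>(arc_diagrams :: ('n list \<times> ('n \<times> 'n) set) set). g (card A))"
    by (subst sum.reindex_bij_betw[OF bij, symmetric]) (simp add: case_prod_unfold)
  finally show ?thesis .
qed

section \<open>Sequences of blocks and words read with a queue\<close>

text \<open>A letter of a flagged word carries two flags: whether an arc ends at it and whether an arc starts at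
it. The number \<open>s\<close> counts the arcs that are open on the left, and all arcs have to
be closed at the end.\<close>

fun balanced :: "nat \<Rightarrow> ('a \<times> bool \<times> bool) list \<Rightarrow> bool" where
  "balanced s [] \<longleftrightarrow> s = 0"
| "balanced s ((x, e, t) # \<omega>) \<longleftrightarrow>
     (e \<longrightarrow> s > 0) \<and> balanced (s - of_bool e + of_bool t) \<omega>"

text \<open>The list \<open>Cs\<close> is a queue of nonempty remainders of blocks. The letter served ends an arc if it comes
from the queue, and starts one if its block is not yet exhausted.\<close>

fun serve :: "'a list list \<Rightarrow> 'a list list \<Rightarrow> ('a \<times> bool \<times> bool) list" where
  "serve Cs [] = []"
| "serve Cs (B # Bs) =
     (let C = (if B = [] then hd Cs else B); Cs' = (if B = [] then tl Cs else Cs)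
      in (hd C, B = [], tl C \<noteq> []) # serve (if tl C = [] then Cs' else Cs' @ [tl C]) Bs)"

text \<open>Inverse to \<open>serve\<close>, working from the right: a letter that starts an arc is put back in front of the
block that it had sent to the end of the queue.\<close>

fun unserve :: "('a \<times> bool \<times> bool) list \<Rightarrow> 'a list list \<times> 'a list list" where
  "unserve [] = ([], [])"
| "unserve ((x, e, t) # \<omega>) =
     (let (Cs, Bs) = unserve \<omega>;
          C = x # (if t then last Cs else []);
          Cs' = (if t then butlast Cs else Cs)
      in if e then (C # Cs', [] # Bs) else (Cs', C # Bs))"

text \<open>The queue, holding \<open>m\<close> letters, never runs dry and ends up empty.\<close>

fun parks :: "nat \<Rightarrow> 'a list list \<Rightarrow> bool" where
  "parks m [] \<longleftrightarrow> m = 0"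
| "parks m (B # Bs) \<longleftrightarrow> m + length B > 0 \<and> parks (m + length B - 1) Bs"

lemma unserve_props:
  assumes "balanced s \<omega>" "unserve \<omega> = (Cs, Bs)"
  shows "length Cs = s" "[] \<notin> set Cs" "length Bs = length \<omega>"
    "parks (length (concat Cs)) Bs" "serve Cs Bs = \<omega>"
    "mset (concat Cs) + mset (concat Bs) = mset (map fst \<omega>)"
proof -
  have "length Cs = s \<and> [] \<notin> set Cs \<and> length Bs = length \<omega> \<and>
    parks (length (concat Cs)) Bs \<and> serve Cs Bs = \<omega> \<and>
    mset (concat Cs) + mset (concat Bs) = mset (map fst \<omega>)"
    using assms
  proof (induction s \<omega> arbitrary: Cs Bs rule: balanced.induct)
    case (1 s)
    then show ?case by simp
  next
    case (2 s x e t \<omega>)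
    obtain Cs1 Bs1 where u: "unserve \<omega> = (Cs1, Bs1)" by fastforce
    have IH: "length Cs1 = s - of_bool e + of_bool t" "[] \<notin> set Cs1" "length Bs1 = length \<omega>"
      "parks (length (concat Cs1)) Bs1" "serve Cs1 Bs1 = \<omega>"
      "mset (concat Cs1) + mset (concat Bs1) = mset (map fst \<omega>)"
      using 2(1)[OF _ u] 2(2) by auto
    show ?case
    proof (cases t)
      case True
      then obtain D C where D: "Cs1 = D @ [C]"
        using IH(1) by (cases Cs1 rule: rev_cases) auto
      show ?thesis using True IH 2(2,3) u D by (cases e) (auto simp: Let_def add.commute add.left_commute)
    next
      case False
      show ?thesis using False IH 2(2,3) u by (cases e) (auto simp: Let_def)
    qed
  qed
  then show "length Cs = s" "[] \<notin> set Cs" "length Bs = length \<omega>"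
    "parks (length (concat Cs)) Bs" "serve Cs Bs = \<omega>"
    "mset (concat Cs) + mset (concat Bs) = mset (map fst \<omega>)" by auto
qed

lemma serve_props:
  assumes "[] \<notin> set Cs" "parks (length (concat Cs)) Bs"
  shows "balanced (length Cs) (serve Cs Bs)" "unserve (serve Cs Bs) = (Cs, Bs)"
proof -
  have "balanced (length Cs) (serve Cs Bs) \<and> unserve (serve Cs Bs) = (Cs, Bs)"
    using assms
  proof (induction Bs arbitrary: Cs)
    case Nil
    then have "Cs = []" by (cases Cs) auto
    then show ?case by simp
  next
    case (Cons B Bs)
    define C where "C = (if B = [] then hd Cs else B)"
    define D where "D = (if B = [] then tl Cs else Cs)"
    define E where "E = (if tl C = [] then D else D @ [tl C])"
    have ne: "B = [] \<Longrightarrow> Cs = C # D"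
      using Cons.prems(2) by (cases Cs) (auto simp: C_def D_def)
    have Cne: "C \<noteq> []"
      using Cons.prems ne C_def by auto
    have "[] \<notin> set D" using Cons.prems(1) by (cases Cs) (auto simp: D_def)
    then have "[] \<notin> set E" by (auto simp: E_def)
    moreover have "length (concat Cs) + length B = length C + length (concat D)"
    proof (cases "B = []")
      case True
      show ?thesis by (subst ne[OF True]) (simp add: True)
    qed (simp add: C_def D_def)
    then have "length (concat E) = length (concat Cs) + length B - 1"
      using Cne by (cases C) (auto simp: E_def)
    then have "parks (length (concat E)) Bs" using Cons.prems by simp
    ultimately have IH: "balanced (length E) (serve E Bs)" "unserve (serve E Bs) = (E, Bs)"
      using Cons.IH by auto
    have s: "serve Cs (B # Bs) = (hd C, B = [], tl C \<noteq> []) # serve E Bs"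
      by (simp add: C_def D_def E_def Let_def)
    have E: "(if tl C \<noteq> [] then last E else []) = tl C"
      "(if tl C \<noteq> [] then butlast E else E) = D" "hd C # tl C = C"
      using Cne by (auto simp: E_def)
    have lE: "length E = length D + of_bool (tl C \<noteq> [])" by (simp add: E_def)
    show ?case
    proof (cases "B = []")
      case True
      note Cs = ne[OF True]
      have "unserve (serve Cs (B # Bs)) = (C # D, [] # Bs)"
        unfolding s unserve.simps IH(2) Let_def prod.case E using True by simp
      moreover have "length Cs = Suc (length D)" using Cs by (metis length_Cons)
      ultimately show ?thesis unfolding s using IH(1) lE Cs True by simp
    next
      case False
      then have CD: "C = B" "D = Cs" by (simp_all add: C_def D_def)
      have "unserve (serve Cs (B # Bs)) = (D, C # Bs)"
        unfolding s unserve.simps IH(2) Let_def prod.case E using False by simp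
      then show ?thesis unfolding s using IH(1) lE False CD by simp
    qed
  qed
  then show "balanced (length Cs) (serve Cs Bs)" "unserve (serve Cs Bs) = (Cs, Bs)" by auto
qed

lemma count_ends_serve:
  "length (filter (\<lambda>(x, e, t). e) (serve Cs Bs)) = length (filter (\<lambda>B. B = []) Bs)"
  by (induction Bs arbitrary: Cs) (auto simp: Let_def)

text \<open>First in, first out: an arc that ends at a letter comes from the head of the queue \<open>Q\<close> of letters
whose arcs are still open.\<close>

fun arcs :: "'a list \<Rightarrow> ('a \<times> bool \<times> bool) list \<Rightarrow> ('a \<times> 'a) set" where
  "arcs Q [] = {}"
| "arcs Q ((x, e, t) # \<omega>) =
     (if e then {(hd Q, x)} else {}) \<union>
     arcs ((if e then tl Q else Q) @ (if t then [x] else [])) \<omega>"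

text \<open>The arcs join consecutive letters of the blocks, where a block that is already pending is preceded
by its last served letter, an entry of \<open>Q\<close>.\<close>

lemma arcs_increasing_iff:
  fixes Q :: "'a::linorder list"
  assumes "balanced s \<omega>" "unserve \<omega> = (Cs, Bs)" "length Q = s"
  shows "(\<forall>(k, l)\<in>arcs Q \<omega>. k < l) \<longleftrightarrow>
    (\<forall>(q, C)\<in>set (zip Q Cs). sorted_wrt (<) (q # C)) \<and> (\<forall>B\<in>set Bs. sorted_wrt (<) B)"
  using assms
proof (induction s \<omega> arbitrary: Q Cs Bs rule: balanced.induct)
  case (1 s)
  then show ?case by simp
next
  case (2 s x e t \<omega>)
  obtain Cs1 Bs1 where u: "unserve \<omega> = (Cs1, Bs1)" by fastforce
  define Q0 where "Q0 = (if e then tl Q else Q)"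
  define Q' where "Q' = Q0 @ (if t then [x] else [])"
  have b: "balanced (s - of_bool e + of_bool t) \<omega>" using 2(2) by simp
  have lQ: "length Q' = s - of_bool e + of_bool t" using 2(4) by (auto simp: Q'_def Q0_def)
  note up = unserve_props[OF b u]
  have IH: "(\<forall>(k, l)\<in>arcs Q' \<omega>. k < l) \<longleftrightarrow>
    (\<forall>(q, C)\<in>set (zip Q' Cs1). sorted_wrt (<) (q # C)) \<and> (\<forall>B\<in>set Bs1. sorted_wrt (<) B)"
    by (rule 2(1)[OF b u lQ])
  have Qe: "Q = hd Q # Q0" if e
    using that 2(2,4) by (cases Q) (auto simp: Q0_def)
  define C0 where "C0 = (if t then last Cs1 else [])"
  define D where "D = (if t then butlast Cs1 else Cs1)"
  have lD: "length Q0 = length D" using lQ up(1) by (cases t) (auto simp: Q'_def D_def)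
  have z: "zip Q' Cs1 = zip Q0 D @ (if t then [(x, C0)] else [])"
  proof (cases t)
    case True
    then have "Cs1 = D @ [C0]" using up(1) by (cases Cs1 rule: rev_cases) (auto simp: D_def C0_def)
    then show ?thesis using True lD by (simp add: Q'_def)
  qed (auto simp: Q'_def D_def)
  have C0: "(\<not> t \<longrightarrow> C0 = [])" by (simp add: C0_def)
  have us: "(Cs, Bs) = (if e then ((x # C0) # D, [] # Bs1) else (D, (x # C0) # Bs1))"
    using 2(3) u by (cases e) (simp_all add: Let_def C0_def D_def)
  have a: "arcs Q ((x, e, t) # \<omega>) = (if e then {(hd Q, x)} else {}) \<union> arcs Q' \<omega>"
    by (simp add: Q'_def Q0_def)
  have x: "(\<forall>(k, l)\<in>arcs Q' \<omega>. k < l) \<longleftrightarrow>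
    sorted_wrt (<) (x # C0) \<and> (\<forall>(q, C)\<in>set (zip Q0 D). sorted_wrt (<) (q # C)) \<and>
    (\<forall>B\<in>set Bs1. sorted_wrt (<) B)"
    unfolding IH z using C0 by (cases t) (simp_all add: ball_Un conj_ac)
  show ?case
  proof (cases e)
    case True
    then have "zip Q Cs = (hd Q, x # C0) # zip Q0 D"
      using us Qe by (metis Pair_inject zip_Cons_Cons)
    moreover have "sorted_wrt (<) (hd Q # x # C0) \<longleftrightarrow> hd Q < x \<and> sorted_wrt (<) (x # C0)"
      by (auto intro: less_trans)
    moreover have "Bs = [] # Bs1" using us True by simp
    ultimately show ?thesis unfolding a using x True by (auto simp del: sorted_wrt.simps(2))
  next
    case False
    then have "zip Q Cs = zip Q0 D" "Bs = (x # C0) # Bs1" using us by (simp_all add: Q0_def)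
    then show ?thesis unfolding a using x False by (auto simp del: sorted_wrt.simps(2))
  qed
qed

section \<open>Nonnesting arcs and queues\<close>

definition nonnesting :: "'a list \<Rightarrow> ('a \<times> 'a) set \<Rightarrow> bool" where
  "nonnesting w A \<longleftrightarrow> (\<forall>a\<in>A. \<forall>b\<in>A. (a, b) \<notin> nested w)"

text \<open>In passing from arcs to flags only the end points are kept; nonnesting arcs are recovered from them
by \<open>arcs\<close>.\<close>

definition flags :: "('a \<times> 'a) set \<Rightarrow> 'a list \<Rightarrow> ('a \<times> bool \<times> bool) list" where
  "flags A w = map (\<lambda>x. (x, x \<in> snd ` A, x \<in> fst ` A)) w"

lemma nonnesting_filter:
  assumes "A \<subseteq> {x. P x} \<times> {x. P x}"
  shows "nonnesting (filter P u) A \<longleftrightarrow> nonnesting u A"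
  using assms unfolding nonnesting_def nested_def before_filter by fast

text \<open>Reading the letter \<open>x\<close> removes the head of the queue if an arc ends at \<open>x\<close>, and removes \<open>x\<close> from view
unless an arc starts there, but it never changes the order of the remaining letters. Hence
nesting among the remaining arcs is unaffected.\<close>

lemma queue_step_eq_filter:
  assumes "distinct (Q @ x # w)" "e \<longrightarrow> Q \<noteq> []"
    and "Q' = (if e then tl Q else Q) @ (if t then [x] else [])"
  shows "Q' @ w = filter (\<lambda>y. y \<in> set (Q' @ w)) (Q @ x # w)"
proof -
  define Q0 where "Q0 = (if e then tl Q else Q)"
  define P where "P = (\<lambda>y. y \<in> set (Q' @ w))"
  have Q: "Q = (if e then [hd Q] else []) @ Q0"
    using assms(2) by (cases Q) (auto simp: Q0_def)
  have d: "distinct ((if e then [hd Q] else []) @ Q0 @ x # w)"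
    using assms(1) arg_cong[OF Q, of "\<lambda>Q. distinct (Q @ x # w)"] by (simp only: append.assoc)
  have Q': "Q' = Q0 @ (if t then [x] else [])" using assms(3) by (simp add: Q0_def)
  have "\<forall>y\<in>set Q0. P y" "\<forall>y\<in>set w. P y" 
    using arg_cong[OF Q', of set] unfolding P_def set_append by blast+
  then have "filter P Q0 = Q0" "filter P w = w" by (metis filter_True)+
  moreover have "P x = t" using d by (cases t) (simp_all add: P_def Q')
  moreover have "\<not> P (hd Q)" if e using d that by (cases t) (simp_all add: P_def Q')
  ultimately have "filter P ((if e then [hd Q] else []) @ Q0 @ x # w) = Q' @ w"
    by (simp add: Q')
  moreover have "(if e then [hd Q] else []) @ Q0 @ x # w = Q @ x # w"
    using arg_cong[OF Q, of "\<lambda>Q. Q @ x # w"] by (simp only: append.assoc)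
  ultimately show ?thesis by (simp only: P_def)
qed

lemma queue_step:
  assumes "distinct (Q @ x # w)" "e \<longrightarrow> Q \<noteq> []"
    and "Q' = (if e then tl Q else Q) @ (if t then [x] else [])"
  shows "distinct (Q' @ w)"
    "before (Q' @ w) = before (Q @ x # w) \<inter> set (Q' @ w) \<times> set (Q' @ w)"
    "A \<subseteq> set (Q' @ w) \<times> set (Q' @ w) \<Longrightarrow>
       nonnesting (Q' @ w) A \<longleftrightarrow> nonnesting (Q @ x # w) A"
proof -
  note fil = queue_step_eq_filter[OF assms]
  show "distinct (Q' @ w)" using assms(1) by (subst fil) (rule distinct_filter)
  show "before (Q' @ w) = before (Q @ x # w) \<inter> set (Q' @ w) \<times> set (Q' @ w)"
    using arg_cong[OF fil, of before] unfolding before_filter by (simp add: Collect_disj_eq)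
  show "nonnesting (Q' @ w) A \<longleftrightarrow> nonnesting (Q @ x # w) A"
    if "A \<subseteq> set (Q' @ w) \<times> set (Q' @ w)"
    using that by (subst fil, subst nonnesting_filter) (simp_all add: Collect_disj_eq)
qed

text \<open>If an arc ends at the first unread letter, it must come from the head of the queue: the arc from the
head ends at this letter or later, and would enclose an arc from any other pending letter
that ends here.\<close>

lemma flags_nonnesting:
  assumes "distinct (Q @ w)" "A \<subseteq> before (Q @ w)" "snd ` A \<subseteq> set w"
    "nonnesting (Q @ w) A" "set Q \<subseteq> fst ` A"
  shows "balanced (length Q) (flags A w) \<and> arcs Q (flags A w) = A"
  using assms
proof (induction w arbitrary: Q A)
  case Nil
  then show ?case by (auto simp: flags_def)
next
  case (Cons x w)
  define e t where "e = (x \<in> snd ` A)" and "t = (x \<in> fst ` A)"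
  define Q' where "Q' = (if e then tl Q else Q) @ (if t then [x] else [])"
  have fl: "flags A (x # w) = (x, e, t) # flags A w" by (simp add: flags_def e_def t_def)
  have xw: "(x, l) \<in> before (Q @ x # w)" if "l \<in> set w" for l
    using that by (simp add: before_append)
  have sub: "k \<in> set Q \<or> k = x \<and> t \<or> k \<in> set w" if "(k, l) \<in> A" for k l
    using that Cons.prems(2) before_subset[of "Q @ x # w"] unfolding t_def by force
  show ?case
  proof (cases e)
    case False
    have Aw: "snd ` A \<subseteq> set w" using Cons.prems(3) False by (auto simp: e_def)
    have "A \<subseteq> set (Q' @ w) \<times> set (Q' @ w)"
      using sub Aw False by (force simp: Q'_def)
    note Asub = this
    have Qne: "e \<longrightarrow> Q \<noteq> []" using False by simp
    note st = queue_step[OF Cons.prems(1) Qne Q'_def]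
    have "A \<subseteq> before (Q' @ w)"
      using Asub Cons.prems(2) st(2) by blast
    moreover have "nonnesting (Q' @ w) A"
      using st(3)[OF Asub] Cons.prems(4) by simp
    moreover have "set Q' \<subseteq> fst ` A" using Cons.prems(5) False by (auto simp: Q'_def t_def)
    moreover have "distinct (Q' @ w)" using Cons.prems(1) False by (auto simp: Q'_def)
    ultimately have "balanced (length Q') (flags A w) \<and> arcs Q' (flags A w) = A"
      using Cons.IH Aw by blast
    then show ?thesis using False by (simp add: fl Q'_def split: if_splits)
  next
    case True
    then obtain k where k: "(k, x) \<in> A" by (auto simp: e_def)
    have "(k, x) \<in> before (Q @ x # w)" using k Cons.prems(2) by blast
    then have "k \<in> set Q"
      using Cons.prems(1) before_subset[of w] by (auto simp: before_append dest: subsetD[OF before_subset])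
    then obtain q Q0 where Q: "Q = q # Q0" by (cases Q) auto
    obtain y where y: "(q, y) \<in> A" using Cons.prems(5) Q by auto
    have nn: "(a, b) \<in> A \<Longrightarrow> (c, d) \<in> A \<Longrightarrow> ((a, b), (c, d)) \<notin> nested (Q @ x # w)" for a b c d
      using Cons.prems(4) unfolding nonnesting_def by blast
    have qf: "(q, l) \<in> before (Q @ x # w)" if "l \<in> set (Q0 @ x # w)" for l
      using that Q by (auto simp: before_append)
    have "k = q"
    proof (rule ccontr)
      assume "k \<noteq> q"
      then have "((k, x), (q, y)) \<in> nested (Q @ x # w)"
        using y Cons.prems(3) xw qf \<open>k \<in> set Q\<close> Q by (force simp: nested_def)
      then show False using nn[OF k y] by blast
    qed
    then have qx: "(q, x) \<in> A" using k by simp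
    have ux: "k = q" if "(k, x) \<in> A" for k
    proof (rule ccontr)
      assume "k \<noteq> q"
      have "k \<in> set (Q @ x # w)" using that Cons.prems(2) before_subset[of "Q @ x # w"] by auto
      then have "((k, x), (q, x)) \<in> nested (Q @ x # w)"
        using \<open>k \<noteq> q\<close> qf Q by (auto simp: nested_def)
      then show False using nn that qx by blast
    qed
    have uq: "l = x" if "(q, l) \<in> A" for l
    proof (rule ccontr)
      assume "l \<noteq> x"
      then have "l \<in> set w" using that Cons.prems(3) by force
      then have "((q, x), (q, l)) \<in> nested (Q @ x # w)" using xw \<open>l \<noteq> x\<close> by (auto simp: nested_def)
      then show False using nn that qx by blast
    qed
    define A' where "A' = A - {(q, x)}"
    have A: "A = insert (q, x) A'" using qx by (auto simp: A'_def)
    have fs: "y \<in> snd ` A \<longleftrightarrow> y \<in> snd ` A'" if "y \<noteq> x" for y using that A by auto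
    have ff: "y \<in> fst ` A \<longleftrightarrow> y \<in> fst ` A'" if "y \<noteq> q" for y using that A by auto
    have fl': "flags A w = flags A' w"
      using Cons.prems(1) Q by (auto simp: flags_def simp del: image_iff intro!: fs ff)
    have Aw: "snd ` A' \<subseteq> set w"
      using Cons.prems(3) ux by (fastforce simp: A'_def)
    have Asub: "A' \<subseteq> set (Q' @ w) \<times> set (Q' @ w)"
    proof clarify
      fix a b assume ab: "(a, b) \<in> A'"
      then have "a \<noteq> q" using uq by (auto simp: A'_def)
      then have "a \<in> set (Q' @ w)" using sub[of a b] ab Q True by (auto simp: Q'_def A'_def)
      then show "a \<in> set (Q' @ w) \<and> b \<in> set (Q' @ w)" using ab Aw by auto
    qed
    have Qne: "e \<longrightarrow> Q \<noteq> []" using Q by simp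
    note st = queue_step[OF Cons.prems(1) Qne Q'_def]
    have "A' \<subseteq> before (Q' @ w)"
      using Asub Cons.prems(2) st(2) unfolding A'_def by blast
    moreover have "nonnesting (Q' @ w) A'"
    proof -
      have "nonnesting (Q @ x # w) A'" using Cons.prems(4) by (auto simp: nonnesting_def A'_def)
      then show ?thesis using st(3)[OF Asub] by simp
    qed
    moreover have "set Q' \<subseteq> fst ` A'"
    proof
      fix z assume "z \<in> set Q'"
      then have "z \<in> fst ` A" "z \<noteq> q"
        using Cons.prems(1,5) Q True by (auto simp: Q'_def t_def split: if_splits)
      then show "z \<in> fst ` A'" using ff by simp
    qed
    moreover have "distinct (Q' @ w)" using Cons.prems(1) True Q by (auto simp: Q'_def)
    ultimately have "balanced (length Q') (flags A' w) \<and> arcs Q' (flags A' w) = A'"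
      using Cons.IH Aw by blast
    then show ?thesis unfolding fl fl' using A True Q by (simp add: Q'_def split: if_splits)
  qed
qed

text \<open>The arc closed first starts at the head of the queue and ends at the first unread letter, hence it
is not nested with any arc that closes later.\<close>

lemma arcs_balanced:
  assumes "balanced (length Q) \<omega>" "distinct (Q @ map fst \<omega>)"
  shows "arcs Q \<omega> \<subseteq> before (Q @ map fst \<omega>)" "snd ` arcs Q \<omega> \<subseteq> set (map fst \<omega>)"
    "nonnesting (Q @ map fst \<omega>) (arcs Q \<omega>)" "set Q \<subseteq> fst ` arcs Q \<omega>"
    "flags (arcs Q \<omega>) (map fst \<omega>) = \<omega>"
    "finite (arcs Q \<omega>)" "card (arcs Q \<omega>) = length (filter (\<lambda>(x, e, t). e) \<omega>)"
proof -
  have "arcs Q \<omega> \<subseteq> before (Q @ map fst \<omega>) \<and> snd ` arcs Q \<omega> \<subseteq> set (map fst \<omega>) \<and>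
    nonnesting (Q @ map fst \<omega>) (arcs Q \<omega>) \<and> set Q \<subseteq> fst ` arcs Q \<omega> \<and>
    flags (arcs Q \<omega>) (map fst \<omega>) = \<omega> \<and>
    finite (arcs Q \<omega>) \<and> card (arcs Q \<omega>) = length (filter (\<lambda>(x, e, t). e) \<omega>)"
    using assms
  proof (induction \<omega> arbitrary: Q)
    case Nil
    then show ?case by (simp add: flags_def nonnesting_def)
  next
    case (Cons a \<omega>)
    obtain x e t where a: "a = (x, e, t)" by (metis prod_cases3)
    define w where "w = map fst \<omega>"
    define Q' where "Q' = (if e then tl Q else Q) @ (if t then [x] else [])"
    define A' where "A' = arcs Q' \<omega>"
    have d: "distinct (Q @ x # w)" using Cons.prems(2) by (simp add: a w_def)
    have Qe: "Q = hd Q # tl Q" if e using Cons.prems(1) that a by (cases Q) auto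
    then have Qne: "e \<longrightarrow> Q \<noteq> []" by fastforce
    have lQ': "length Q' = length Q - of_bool e + of_bool t" by (simp add: Q'_def)
    have d': "distinct (Q' @ w)" by (rule queue_step(1)[OF d Qne Q'_def])
    have "balanced (length Q') \<omega>" using Cons.prems(1) lQ' a by simp
    from Cons.IH[OF this] d'
    have IH: "A' \<subseteq> before (Q' @ w)" "snd ` A' \<subseteq> set w" "nonnesting (Q' @ w) A'" "set Q' \<subseteq> fst ` A'"
      "flags A' w = \<omega>" "finite A'" "card A' = length (filter (\<lambda>(x, e, t). e) \<omega>)"
      unfolding w_def A'_def by auto
    have A: "arcs Q (a # \<omega>) = (if e then {(hd Q, x)} else {}) \<union> A'"
      by (simp add: a A'_def Q'_def)
    note st = queue_step[OF d Qne Q'_def]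
    have Asub: "A' \<subseteq> set (Q' @ w) \<times> set (Q' @ w)"
      using IH(1) before_subset by blast
    have bef: "A' \<subseteq> before (Q @ x # w)"
      using IH(1) st(2) by blast
    have nnA: "nonnesting (Q @ x # w) A'"
      using IH(3) st(3)[OF Asub] by simp
    have qx: "(hd Q, x) \<in> before (Q @ x # w)" if e
      using Qne that by (simp add: before_append)
    have hq: "hd Q \<notin> set (Q' @ w)" "hd Q \<noteq> x" if e
    proof -
      have "distinct (hd Q # tl Q @ x # w)" using d Qe[OF that] by (metis append_Cons)
      then show "hd Q \<notin> set (Q' @ w)" "hd Q \<noteq> x" using that by (auto simp: Q'_def)
    qed
    have nn: "nonnesting (Q @ x # w) (arcs Q (a # \<omega>))"
    proof -
      have "((hd Q, x), (k, l)) \<notin> nested (Q @ x # w) \<and> ((k, l), (hd Q, x)) \<notin> nested (Q @ x # w)"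
        if e and kl: "(k, l) \<in> A'" for k l
      proof -
        have "k \<noteq> hd Q" "k \<in> set (Q' @ w)" using hq[OF \<open>e\<close>] Asub kl by auto
        then have "(hd Q, k) \<in> before (hd Q # tl Q @ x # w)" using Qe \<open>e\<close>
          by (auto simp: Q'_def before_append split: if_splits)
        then have 1: "(hd Q, k) \<in> before (Q @ x # w)" using Qe[OF \<open>e\<close>] by (metis append_Cons)
        have 2: "l \<noteq> x" "(x, l) \<in> before (Q @ x # w)"
          using IH(2) kl d by (auto simp: before_append)
        show ?thesis using 1 2 before_asym[OF d] \<open>k \<noteq> hd Q\<close> by (auto simp: nested_def)
      qed
      moreover have "(p, p) \<notin> nested (Q @ x # w)" for p by (auto simp: nested_def)
      ultimately show ?thesis using nnA unfolding A nonnesting_def by auto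
    qed
    have xA: "x \<notin> snd ` A'" using IH(2) d by auto
    have fl: "flags (arcs Q (a # \<omega>)) (x # w) = a # \<omega>"
    proof -
      have "x \<in> snd ` arcs Q (a # \<omega>) \<longleftrightarrow> e" unfolding A using xA by auto
      moreover have "x \<in> fst ` arcs Q (a # \<omega>) \<longleftrightarrow> t"
      proof
        assume "x \<in> fst ` arcs Q (a # \<omega>)"
        then have "x \<in> fst ` A'" using hq unfolding A by (auto split: if_splits)
        then have "x \<in> set (Q' @ w)" using Asub by auto
        then show t using d by (cases Q) (auto simp: Q'_def split: if_splits)
      next
        assume t
        then show "x \<in> fst ` arcs Q (a # \<omega>)" using IH(4) unfolding A by (auto simp: Q'_def)
      qed
      moreover have "flags (arcs Q (a # \<omega>)) w = flags A' w"
        unfolding A flags_def using d hq by (auto split: if_splits)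
      ultimately show ?thesis using IH(5) unfolding a by (simp only: flags_def list.map)
    qed
    have Qf: "set Q \<subseteq> fst ` arcs Q (a # \<omega>)"
    proof
      fix z assume z: "z \<in> set Q"
      show "z \<in> fst ` arcs Q (a # \<omega>)"
      proof (cases "e \<and> z = hd Q")
        case True then show ?thesis unfolding A by force
      next
        case False
        then have "z \<in> set Q'" using z by (cases Q) (auto simp: Q'_def)
        then show ?thesis using IH(4) unfolding A by auto
      qed
    qed
    have "card (arcs Q (a # \<omega>)) = length (filter (\<lambda>(x, e, t). e) (a # \<omega>))"
    proof -
      have "(hd Q, x) \<notin> A'" using xA by force
      then show ?thesis using IH(6,7) unfolding A by (simp add: a)
    qed
    moreover have "map fst (a # \<omega>) = x # w" by (simp add: a w_def)
    moreover have "finite (arcs Q (a # \<omega>))" "arcs Q (a # \<omega>) \<subseteq> before (Q @ x # w)"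
      "snd ` arcs Q (a # \<omega>) \<subseteq> set (x # w)"
      unfolding A using IH(2,6) qx bef by auto
    ultimately show ?case using nn fl Qf by simp
  qed
  then show "arcs Q \<omega> \<subseteq> before (Q @ map fst \<omega>)" "snd ` arcs Q \<omega> \<subseteq> set (map fst \<omega>)"
    "nonnesting (Q @ map fst \<omega>) (arcs Q \<omega>)" "set Q \<subseteq> fst ` arcs Q \<omega>"
    "flags (arcs Q \<omega>) (map fst \<omega>) = \<omega>"
    "finite (arcs Q \<omega>)" "card (arcs Q \<omega>) = length (filter (\<lambda>(x, e, t). e) \<omega>)" by auto
qed

section \<open>Arc diagrams and sequences of blocks\<close>

lemma parks_iff:
  "parks m Bs \<longleftrightarrow> (\<forall>p\<le>length Bs. p \<le> m + length (concat (take p Bs))) \<and>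
     m + length (concat Bs) = length Bs"
proof (induction Bs arbitrary: m)
  case (Cons B Bs)
  have "(\<forall>p\<le>length (B # Bs). p \<le> m + length (concat (take p (B # Bs)))) \<longleftrightarrow>
    (\<forall>p\<le>length Bs. Suc p \<le> m + length B + length (concat (take p Bs)))" (is "?L \<longleftrightarrow> ?R")
  proof
    assume L: ?L
    show ?R
    proof (intro allI impI)
      fix p assume "p \<le> length Bs"
      then show "Suc p \<le> m + length B + length (concat (take p Bs))"
        using L[rule_format, of "Suc p"] by simp
    qed
  next
    assume R: ?R
    show ?L
    proof (intro allI impI)
      fix p assume "p \<le> length (B # Bs)"
      then show "p \<le> m + length (concat (take p (B # Bs)))"
        using R[rule_format, of "p - 1"] by (cases p) auto
    qed
  qed
  note LR = this
  show ?case
  proof (cases "m + length B")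
    case 0
    then have "\<not> ?R" by (auto intro!: exI[of _ 0])
    then show ?thesis using 0 LR by (simp only: parks.simps) simp
  next
    case (Suc k)
    have "parks m (B # Bs) \<longleftrightarrow> parks k Bs" using Suc by simp
    moreover have "?R \<longleftrightarrow> (\<forall>p\<le>length Bs. p \<le> k + length (concat (take p Bs)))"
      using Suc by simp
    moreover have "m + length (concat (B # Bs)) = length (B # Bs) \<longleftrightarrow> k + length (concat Bs) = length Bs"
      using Suc by (simp only: concat.simps length_append list.size) linarith
    ultimately show ?thesis using LR Cons[of k] by (simp only:)
  qed
qed simp

definition block_sequences :: "'n::{finite,linorder} list list set" where
  "block_sequences = {Bs. length Bs = CARD('n) \<and> parks 0 Bs \<and> set (concat Bs) = UNIV \<and>
     (\<forall>B\<in>set Bs. sorted_wrt (<) B)}"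

lemma block_sequences_distinct:
  fixes Bs :: "'n::{finite,linorder} list list"
  assumes "Bs \<in> block_sequences"
  shows "distinct (concat Bs)"
  using assms unfolding block_sequences_def parks_iff by (intro card_distinct) auto

lemma blocks_of_arc_diagram:
  fixes w :: "'n::{finite,linorder} list"
  assumes "(w, A) \<in> arc_diagrams"
  defines "Bs \<equiv> snd (unserve (flags A w))"
  shows "Bs \<in> block_sequences" "map fst (serve [] Bs) = w" "arcs [] (serve [] Bs) = A"
proof -
  have w: "distinct w" "set w = UNIV" and A: "A \<subseteq> ascents w" "nonnesting w A"
    using assms(1) by (auto simp: arc_diagrams_def antichains_def nonnesting_def)
  have "A \<subseteq> before w" "snd ` A \<subseteq> set w" using A w by (auto simp: ascents_def)
  then have b: "balanced 0 (flags A w)" and a: "arcs [] (flags A w) = A"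
    using flags_nonnesting[of "[]" w A] w A by auto
  have m: "map fst (flags A w) = w" by (simp add: flags_def comp_def)
  obtain Cs where u: "unserve (flags A w) = (Cs, Bs)" unfolding Bs_def by (metis prod.collapse)
  note up = unserve_props[OF b u]
  have Cs: "Cs = []" using up(1) by simp
  have s: "serve [] Bs = flags A w" using up(5) Cs by simp
  show "map fst (serve [] Bs) = w" "arcs [] (serve [] Bs) = A" using s m a by simp_all
  have "\<forall>(k, l)\<in>arcs [] (flags A w). k < l" using A(1) a by (auto simp: ascents_def)
  then have "\<forall>B\<in>set Bs. sorted_wrt (<) B"
    using arcs_increasing_iff[OF b u, of "[]"] by simp
  moreover have "mset (concat Bs) = mset w" using up(6) m Cs by simp
  then have "set (concat Bs) = UNIV" using w(2) mset_eq_setD by metis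
  moreover have "length Bs = CARD('n)"
    using up(3) distinct_card[OF w(1)] w(2) by (simp add: flags_def)
  moreover have "parks 0 Bs" using up(4) Cs by simp
  ultimately show "Bs \<in> block_sequences" by (simp add: block_sequences_def)
qed

lemma arc_diagram_of_blocks:
  fixes Bs :: "'n::{finite,linorder} list list"
  assumes "Bs \<in> block_sequences"
  defines "w \<equiv> map fst (serve [] Bs)" and "A \<equiv> arcs [] (serve [] Bs)"
  shows "(w, A) \<in> arc_diagrams" "snd (unserve (flags A w)) = Bs"
    "card A = length (filter (\<lambda>B. B = []) Bs)"
proof -
  have B: "parks 0 Bs" "set (concat Bs) = UNIV" "\<forall>B\<in>set Bs. sorted_wrt (<) B"
    using assms(1) by (auto simp: block_sequences_def)
  have b: "balanced 0 (serve [] Bs)" and u: "unserve (serve [] Bs) = ([], Bs)"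
    using serve_props[of "[]" Bs] B(1) by simp_all
  have "mset (concat Bs) = mset w" unfolding w_def using unserve_props(6)[OF b u] by simp
  then have w: "distinct w" "set w = UNIV"
    using block_sequences_distinct[OF assms(1)] B(2) mset_eq_imp_distinct_iff mset_eq_setD
    by metis+
  have b0: "balanced (length []) (serve [] Bs)" and d0: "distinct ([] @ map fst (serve [] Bs))"
    using b w(1) by (simp_all add: w_def)
  note ab = arcs_balanced[OF b0 d0, folded A_def w_def, unfolded append_Nil]
  have "\<forall>(k, l)\<in>A. k < l" using arcs_increasing_iff[OF b u, of "[]"] B(3) by (simp add: A_def)
  then have "A \<subseteq> ascents w" using ab(1) by (auto simp: ascents_def w_def)
  then show "(w, A) \<in> arc_diagrams"
    using w ab(3) by (auto simp: arc_diagrams_def antichains_def nonnesting_def w_def)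
  show "snd (unserve (flags A w)) = Bs" using ab(5) u by (simp add: w_def)
  show "card A = length (filter (\<lambda>B. B = []) Bs)"
    using ab(7) count_ends_serve[of "[]" Bs] by simp
qed

lemma sum_arc_diagrams_eq_blocks:
  "(\<Sum>(w, A)\<in>(arc_diagrams :: ('n::{finite,linorder} list \<times> ('n \<times> 'n) set) set). g (card A)) =
   (\<Sum>Bs\<in>(block_sequences :: 'n list list set). g (length (filter (\<lambda>B. B = []) Bs)))"
proof (rule sum.reindex_bij_witness[where i = "\<lambda>Bs. (map fst (serve [] Bs), arcs [] (serve [] Bs))"
      and j = "\<lambda>(w, A). snd (unserve (flags A w))"])
  fix p assume "p \<in> (arc_diagrams :: ('n list \<times> ('n \<times> 'n) set) set)"
  then obtain w A where p: "p = (w, A)" "(w, A) \<in> arc_diagrams" by (cases p) auto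
  note d = blocks_of_arc_diagram[OF p(2)]
  show "(map fst (serve [] (case p of (w, A) \<Rightarrow> snd (unserve (flags A w)))),
      arcs [] (serve [] (case p of (w, A) \<Rightarrow> snd (unserve (flags A w))))) = p"
    using d by (simp add: p(1))
  show "(case p of (w, A) \<Rightarrow> snd (unserve (flags A w))) \<in> block_sequences"
    using d by (simp add: p(1))
  show "g (length (filter (\<lambda>B. B = []) (case p of (w, A) \<Rightarrow> snd (unserve (flags A w))))) =
      (case p of (w, A) \<Rightarrow> g (card A))"
    using arc_diagram_of_blocks(3)[OF d(1)] d by (simp add: p(1))
qed (use arc_diagram_of_blocks in auto)

section \<open>Parking functions and cyclic shifts\<close>

text \<open>The \<open>p\<close>-th smallest value is at most \<open>p\<close> exactly if at least \<open>p\<close> values are at most \<open>p\<close>.\<close>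

lemma parking_functions_iff:
  "a \<in> parking_functions n \<longleftrightarrow>
     length a = n \<and> set a \<subseteq> {1..n} \<and> (\<forall>p\<le>n. p \<le> card {i. i < n \<and> a ! i \<le> p})"
proof (cases "length a = n \<and> set a \<subseteq> {1..n}")
  case True
  define b where "b = sort a"
  have lb: "length b = n" and sb: "sorted b" using True by (simp_all add: b_def)
  have cnt: "card {i. i < n \<and> a ! i \<le> p} = card {i. i < n \<and> b ! i \<le> p}" for p
  proof -
    have "length (filter (\<lambda>v. v \<le> p) a) = length (filter (\<lambda>v. v \<le> p) b)"
      using mset_filter[of "\<lambda>v. v \<le> p"] by (metis b_def mset_sort size_mset)
    then show ?thesis using True lb by (simp add: length_filter_conv_card)
  qed
  have "(\<forall>i<n. b ! i \<le> i + 1) \<longleftrightarrow> (\<forall>p\<le>n. p \<le> card {i. i < n \<and> b ! i \<le> p})"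
  proof (intro iffI allI impI)
    fix p assume *: "\<forall>i<n. b ! i \<le> i + 1" "p \<le> n"
    have "{..<p} \<subseteq> {i. i < n \<and> b ! i \<le> p}"
    proof
      fix i assume "i \<in> {..<p}"
      then show "i \<in> {i. i < n \<and> b ! i \<le> p}" using *(1)[rule_format, of i] *(2) by simp
    qed
    then have "card {..<p} \<le> card {i. i < n \<and> b ! i \<le> p}" by (intro card_mono) auto
    then show "p \<le> card {i. i < n \<and> b ! i \<le> p}" by simp
  next
    fix i assume *: "\<forall>p\<le>n. p \<le> card {i. i < n \<and> b ! i \<le> p}" "i < n"
    show "b ! i \<le> i + 1"
    proof (rule ccontr)
      assume gt: "\<not> b ! i \<le> i + 1"
      have "{j. j < n \<and> b ! j \<le> i + 1} \<subseteq> {..<i}"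
      proof (rule ccontr)
        assume "\<not> {j. j < n \<and> b ! j \<le> i + 1} \<subseteq> {..<i}"
        then obtain j where "j < n" "b ! j \<le> i + 1" "i \<le> j"
          unfolding subset_iff by (auto simp: not_less)
        then show False using gt sorted_nth_mono[OF sb, of i j] lb by simp
      qed
      then have "card {j. j < n \<and> b ! j \<le> i + 1} \<le> card {..<i}" by (intro card_mono) auto
      moreover have "i + 1 \<le> card {j. j < n \<and> b ! j \<le> i + 1}" using * by simp
      ultimately show False by simp
    qed
  qed
  then show ?thesis using True unfolding parking_functions_def mem_Collect_eq b_def[symmetric] cnt by simp
next
  case False
  then show ?thesis by (auto simp: parking_functions_def)
qed

lemma sum_count_list_eq_card:
  "(\<Sum>u<p. count_list a (Suc u)) = card {i. i < length a \<and> a ! i \<in> {1..p}}"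
proof (induction p)
  case (Suc p)
  have "card {i. i < length a \<and> a ! i \<in> {1..Suc p}} =
    card ({i. i < length a \<and> a ! i \<in> {1..p}} \<union> {i. i < length a \<and> a ! i = Suc p})"
    by (intro arg_cong[of _ _ card]) auto
  also have "\<dots> = card {i. i < length a \<and> a ! i \<in> {1..p}} + card {i. i < length a \<and> a ! i = Suc p}"
    by (intro card_Un_disjoint) auto
  also have "card {i. i < length a \<and> a ! i = Suc p} = count_list a (Suc p)"
    by (simp add: count_list_eq_length_filter length_filter_conv_card eq_commute[of "Suc p"])
  finally show ?case using Suc by simp
qed simp

text \<open>The values \<open>1, \<dots>, n + 1\<close> are repeated periodically; the count runs over the first \<open>p\<close> of these
repeated values. By \<open>cyclic_count_period\<close> it gains \<open>n\<close> over each period of length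
\<open>n + 1\<close>, which is why its excess over \<open>p\<close> decreases by one per period.\<close>

definition cyclic_count :: "nat \<Rightarrow> nat list \<Rightarrow> nat \<Rightarrow> nat" where
  "cyclic_count n a p = (\<Sum>u<p. count_list a (u mod (n + 1) + 1))"

definition rotate_values :: "nat \<Rightarrow> nat \<Rightarrow> nat list \<Rightarrow> nat list" where
  "rotate_values n k a = map (\<lambda>v. (v - 1 + k) mod (n + 1) + 1) a"

lemma cyclic_count_eq_card:
  assumes "p \<le> n + 1"
  shows "cyclic_count n a p = card {i. i < length a \<and> a ! i \<in> {1..p}}"
  unfolding cyclic_count_def sum_count_list_eq_card[symmetric] using assms by (intro sum.cong) auto

lemma parking_iff_cyclic_count:
  assumes "a \<in> all_sequences n"
  shows "a \<in> parking_functions n \<longleftrightarrow> (\<forall>p\<le>n. p \<le> cyclic_count n a p)"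
proof -
  have l: "length a = n" and s: "set a \<subseteq> {1..n + 1}" using assms by (auto simp: all_sequences_def)
  have pos: "1 \<le> a ! i" if "i < n" for i using s l that nth_mem[of i a] by force
  have c: "cyclic_count n a p = card {i. i < n \<and> a ! i \<le> p}" if "p \<le> n" for p
    using cyclic_count_eq_card[of p n a] that pos l by (auto intro!: arg_cong[of _ _ card])
  have "set a \<subseteq> {1..n}" if "n \<le> card {i. i < n \<and> a ! i \<le> n}"
  proof -
    have "{i. i < n \<and> a ! i \<le> n} = {..<n}"
      using that by (intro card_seteq) auto
    then show ?thesis using pos l by (auto simp: in_set_conv_nth)
  qed
  then show ?thesis unfolding parking_functions_iff using l c by auto
qed

lemma cyclic_count_period:
  assumes "a \<in> all_sequences n"
  shows "cyclic_count n a (p + (n + 1)) = cyclic_count n a p + n"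
proof (induction p)
  case 0
  have "{i. i < length a \<and> a ! i \<in> {1..n + 1}} = {..<n}"
    using assms by (auto simp: all_sequences_def dest: nth_mem)
  then show ?case using cyclic_count_eq_card[of "n + 1" n a] by (simp add: cyclic_count_def)
next
  case (Suc p)
  have "cyclic_count n a (Suc q) = cyclic_count n a q + count_list a (q mod (n + 1) + 1)" for q
    by (simp add: cyclic_count_def)
  from this[of p] this[of "p + (n + 1)"] Suc show ?case by (simp del: One_nat_def)
qed

lemma rotate_value_inverse:
  fixes v k :: nat
  assumes "v \<in> {1..n + 1}" "k \<le> n + 1"
  shows "((v - 1 + k) mod (n + 1) + (n + 1 - k)) mod (n + 1) + 1 = v"
proof -
  have "((v - 1 + k) mod (n + 1) + (n + 1 - k)) mod (n + 1) = (v - 1 + k + (n + 1 - k)) mod (n + 1)"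
    by (rule mod_add_left_eq)
  also have "v - 1 + k + (n + 1 - k) = v - 1 + (n + 1)" using assms by simp
  also have "\<dots> mod (n + 1) = v - 1" using assms by (subst mod_add_self2) auto
  finally show ?thesis using assms by simp
qed

lemma inj_on_rotate_value:
  fixes k n :: nat
  assumes "k \<le> n + 1"
  shows "inj_on (\<lambda>v. (v - 1 + k) mod (n + 1) + 1) {1..n + 1}"
  using rotate_value_inverse[OF _ assms]
  by (intro inj_on_inverseI[where g = "\<lambda>v. (v - 1 + (n + 1 - k)) mod (n + 1) + 1"]) simp

lemma rotate_values_all_sequences:
  assumes "a \<in> all_sequences n" "k \<le> n + 1"
  shows "rotate_values n k a \<in> all_sequences n" "num_distinct (rotate_values n k a) = num_distinct a"
proof -
  have s: "set a \<subseteq> {1..n + 1}" using assms by (simp add: all_sequences_def)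
  show "rotate_values n k a \<in> all_sequences n"
    using assms by (auto simp: all_sequences_def rotate_values_def less_Suc_eq_le[symmetric])
  show "num_distinct (rotate_values n k a) = num_distinct a"
    using inj_on_subset[OF inj_on_rotate_value[OF assms(2)] s]
    by (simp add: num_distinct_def rotate_values_def card_image)
qed

lemma cyclic_count_rotate_values:
  assumes "a \<in> all_sequences n" "k \<le> n + 1"
  shows "cyclic_count n (rotate_values n k a) (k + p) =
    cyclic_count n (rotate_values n k a) k + cyclic_count n a p"
proof (induction p)
  case (Suc p)
  let ?f = "\<lambda>v. (v - 1 + k) mod (n + 1) + 1"
  have s: "set a \<subseteq> {1..n + 1}" using assms by (simp add: all_sequences_def)
  have "count_list (map ?f a) (?f v) = count_list a v" if v: "v \<in> {1..n + 1}" for v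
  proof -
    have "filter (\<lambda>u. ?f v = ?f u) a = filter (\<lambda>u. v = u) a"
    proof (intro filter_cong refl)
      fix u assume "u \<in> set a"
      then show "?f v = ?f u \<longleftrightarrow> v = u"
        using s v inj_on_eq_iff[OF inj_on_rotate_value[OF assms(2)], of v u] by blast
    qed
    then show ?thesis by (simp add: count_list_eq_length_filter filter_map comp_def)
  qed
  from this[of "p mod (n + 1) + 1"]
  have "count_list (rotate_values n k a) ((k + p) mod (n + 1) + 1) = count_list a (p mod (n + 1) + 1)"
    by (simp add: rotate_values_def mod_simps add.commute)
  then show ?case using Suc by (simp add: cyclic_count_def)
qed (simp add: cyclic_count_def)

lemma rotate_values_inverse:
  assumes "a \<in> all_sequences n" "k \<le> n + 1"
  shows "rotate_values n (n + 1 - k) (rotate_values n k a) = a"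
    "rotate_values n k (rotate_values n (n + 1 - k) a) = a"
proof -
  have s: "set a \<subseteq> {1..n + 1}" using assms by (simp add: all_sequences_def)
  from rotate_value_inverse[OF _ assms(2)] rotate_value_inverse[of _ n "n + 1 - k"] show
    "rotate_values n (n + 1 - k) (rotate_values n k a) = a"
    "rotate_values n k (rotate_values n (n + 1 - k) a) = a"
    using s assms(2) by (auto simp: rotate_values_def intro!: map_idI)
qed

text \<open>Shifting the values back by \<open>k\<close> makes the periodic count start at \<open>k\<close>.\<close>

lemma rotation_parks_iff:
  assumes "b \<in> all_sequences n" "k \<le> n + 1"
  shows "rotate_values n (n + 1 - k) b \<in> parking_functions n \<longleftrightarrow>
    (\<forall>p\<le>n. cyclic_count n b k + p \<le> cyclic_count n b (k + p))"
proof -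
  let ?a = "rotate_values n (n + 1 - k) b"
  have a: "?a \<in> all_sequences n" using assms by (simp add: rotate_values_all_sequences)
  have "cyclic_count n b (k + p) = cyclic_count n b k + cyclic_count n ?a p" for p
    using cyclic_count_rotate_values[OF a assms(2), of p] rotate_values_inverse(2)[OF assms] by simp
  then show ?thesis unfolding parking_iff_cyclic_count[OF a] by simp
qed

text \<open>The cycle lemma: take the first \<open>k\<close> in a period at which the count minus its argument is minimal.
Later in the same period this difference is not smaller; in the next one it is one less than
at an argument before \<open>k\<close>, where it was strictly above the minimum.\<close>

lemma exists_parking_rotation:
  assumes b: "b \<in> all_sequences n"
  shows "\<exists>k\<le>n. \<forall>p\<le>n. cyclic_count n b k + p \<le> cyclic_count n b (k + p)"
proof -
  define D where "D k = int (cyclic_count n b k) - int k" for k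
  define m where "m = Min (D ` {..n})"
  have m: "m \<le> D k" if "k \<le> n" for k using that by (simp add: m_def)
  have "m \<in> D ` {..n}" unfolding m_def by (intro Min_in) auto
  then have "\<exists>k. k \<le> n \<and> D k = m" by auto
  define k where "k = (LEAST k. k \<le> n \<and> D k = m)"
  have k: "k \<le> n" "D k = m"
    using LeastI_ex[OF \<open>\<exists>k. k \<le> n \<and> D k = m\<close>] by (simp_all add: k_def)
  have first: "m < D j" if "j < k" for j
    using not_less_Least[of j "\<lambda>k. k \<le> n \<and> D k = m"] m[of j] that k(1) by (fastforce simp: k_def)
  have "cyclic_count n b k + p \<le> cyclic_count n b (k + p)" if p: "p \<le> n" for p
  proof (cases "k + p \<le> n")
    case True
    then show ?thesis using m[OF True] k(2) by (simp add: D_def)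
  next
    case False
    \<comment> \<open>the argument one period earlier, which precedes \<open>k\<close>\<close>
    define j where "j = k + p - (n + 1)"
    have j: "k + p = j + (n + 1)" "j < k" using False p by (auto simp: j_def)
    have "cyclic_count n b (k + p) = cyclic_count n b j + n"
      unfolding j(1) by (rule cyclic_count_period[OF b])
    then show ?thesis using first[OF j(2)] k(2) j(1) by (simp add: D_def)
  qed
  then show ?thesis using k(1) by blast
qed

text \<open>Going from \<open>k\<close> to \<open>k'\<close> and on to \<open>k + n + 1\<close> would make the count grow by at least \<open>n + 1\<close> over a period.\<close>

lemma parking_rotation_unique:
  assumes b: "b \<in> all_sequences n" and "k < k'" "k' \<le> n"
    and "\<forall>p\<le>n. cyclic_count n b k + p \<le> cyclic_count n b (k + p)"
  shows "\<not> (\<forall>p\<le>n. cyclic_count n b k' + p \<le> cyclic_count n b (k' + p))"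
proof
  assume *: "\<forall>p\<le>n. cyclic_count n b k' + p \<le> cyclic_count n b (k' + p)"
  have "cyclic_count n b k + (k' - k) \<le> cyclic_count n b k'"
    using assms(4)[rule_format, of "k' - k"] assms(2,3) by simp
  moreover have "cyclic_count n b k' + (k + (n + 1) - k') \<le> cyclic_count n b (k + (n + 1))"
    using *[rule_format, of "k + (n + 1) - k'"] assms(2,3) by simp
  moreover have "cyclic_count n b (k + (n + 1)) = cyclic_count n b k + n"
    by (rule cyclic_count_period[OF b])
  ultimately show False using assms(2,3) by linarith
qed

lemma parking_functions_subset: "parking_functions n \<subseteq> all_sequences n"
  by (auto simp: parking_functions_def all_sequences_def)

lemma bij_betw_parking_rotations:
  "bij_betw (\<lambda>(a, k). rotate_values n k a) (parking_functions n \<times> {..n}) (all_sequences n)"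
  unfolding bij_betw_def
proof
  have good: "\<forall>p\<le>n. cyclic_count n (rotate_values n k a) k + p \<le> cyclic_count n (rotate_values n k a) (k + p)"
    "rotate_values n k a \<in> all_sequences n"
    if "a \<in> parking_functions n" "k \<le> n" for a k
  proof -
    have a: "a \<in> all_sequences n" using that parking_functions_subset by blast
    then show b: "rotate_values n k a \<in> all_sequences n" using that by (intro rotate_values_all_sequences) simp_all
    show "\<forall>p\<le>n. cyclic_count n (rotate_values n k a) k + p \<le> cyclic_count n (rotate_values n k a) (k + p)"
      using rotation_parks_iff[OF b, of k] rotate_values_inverse(1)[OF a, of k] that by simp
  qed
  show "inj_on (\<lambda>(a, k). rotate_values n k a) (parking_functions n \<times> {..n})"
  proof (rule inj_onI, clarify)
    fix a k a' k'
    assume *: "a \<in> parking_functions n" "k \<le> n" "a' \<in> parking_functions n" "k' \<le> n"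
      "rotate_values n k a = rotate_values n k' a'"
    have "k = k'"
      using parking_rotation_unique[OF good(2)[OF *(1,2)], of k k']
        parking_rotation_unique[OF good(2)[OF *(1,2)], of k' k]
        good(1)[OF *(1,2)] good(1)[OF *(3,4)] * by (metis linorder_neqE_nat)
    moreover have "a = rotate_values n (n + 1 - k) (rotate_values n k a)"
      "a' = rotate_values n (n + 1 - k') (rotate_values n k' a')"
      using * parking_functions_subset rotate_values_inverse(1) by (metis subsetD le_add1 le_trans)+
    ultimately show "a = a' \<and> k = k'" using *(5) by metis
  qed
  show "(\<lambda>(a, k). rotate_values n k a) ` (parking_functions n \<times> {..n}) = all_sequences n"
  proof (intro equalityI subsetI)
    fix b assume b: "b \<in> all_sequences n"
    then obtain k where k: "k \<le> n" "\<forall>p\<le>n. cyclic_count n b k + p \<le> cyclic_count n b (k + p)"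
      using exists_parking_rotation by blast
    then have "rotate_values n (n + 1 - k) b \<in> parking_functions n"
      using rotation_parks_iff[OF b, of k] by simp
    moreover have "b = rotate_values n k (rotate_values n (n + 1 - k) b)"
      using rotate_values_inverse(2)[OF b, of k] k by simp
    ultimately show "b \<in> (\<lambda>(a, k). rotate_values n k a) ` (parking_functions n \<times> {..n})"
      using k(1) by (auto intro!: image_eqI[of _ _ "(rotate_values n (n + 1 - k) b, k)"])
  qed (use good(2) in auto)
qed

lemma sum_all_sequences_eq_parking:
  fixes g :: "nat \<Rightarrow> 'b::comm_semiring_1"
  shows "(\<Sum>a\<in>all_sequences n. g (num_distinct a)) =
    (of_nat n + 1) * (\<Sum>a\<in>parking_functions n. g (num_distinct a))"
proof -
  have "(\<Sum>a\<in>all_sequences n. g (num_distinct a)) =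
    (\<Sum>(a, k)\<in>parking_functions n \<times> {..n}. g (num_distinct (rotate_values n k a)))"
    by (subst sum.reindex_bij_betw[OF bij_betw_parking_rotations, symmetric])
      (simp add: case_prod_unfold)
  also have "\<dots> = (\<Sum>(a, k)\<in>parking_functions n \<times> {..n}. g (num_distinct a))"
    using parking_functions_subset rotate_values_all_sequences(2)
    by (intro sum.cong refl) (fastforce)
  also have "\<dots> = (\<Sum>a\<in>parking_functions n. \<Sum>k\<le>n. g (num_distinct a))"
    by (rule sum.cartesian_product[symmetric])
  also have "\<dots> = (of_nat n + 1) * (\<Sum>a\<in>parking_functions n. g (num_distinct a))"
    by (simp add: sum_distrib_left algebra_simps)
  finally show ?thesis .
qed

section \<open>Parking functions and sequences of blocks\<close>

text \<open>The \<open>i\<close>-th letter in increasing order has preference \<open>a ! i\<close>; the positions in a sequence of blocks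
start at 0, whereas preferences start at 1.\<close>

definition preference_block :: "nat list \<Rightarrow> nat \<Rightarrow> 'n::{finite,linorder} list" where
  "preference_block a p = map ((!) (sorted_list_of_set UNIV)) (filter (\<lambda>i. a ! i = Suc p) [0..<length a])"

definition preference_blocks :: "nat list \<Rightarrow> 'n::{finite,linorder} list list" where
  "preference_blocks a = map (preference_block a) [0..<CARD('n)]"

lemma length_concat_preference_blocks:
  assumes "p \<le> CARD('n)"
  shows "length (concat (take p (preference_blocks a :: 'n::{finite,linorder} list list))) =
    card {i. i < length a \<and> a ! i \<in> {1..p}}"
proof -
  have "take p (preference_blocks a :: 'n list list) = map (preference_block a) [0..<p]"
    using assms by (simp add: preference_blocks_def take_map)
  moreover have "length (concat (map (preference_block a :: nat \<Rightarrow> 'n list) [0..<p])) =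
      (\<Sum>u<p. count_list a (Suc u))"
  proof (induction p)
    case (Suc p)
    have "length (preference_block a p :: 'n list) = count_list a (Suc p)"
      by (simp add: preference_block_def count_list_eq_length_filter length_filter_conv_card
          eq_commute[of "Suc p"]) (rule arg_cong[of _ _ card], auto)
    then show ?case using Suc by simp
  qed simp
  ultimately show ?thesis by (simp only: sum_count_list_eq_card)
qed

lemma set_preference_block:
  "set (preference_block a p) = {sorted_list_of_set UNIV ! i | i. i < length a \<and> a ! i = Suc p}"
  by (auto simp: preference_block_def)

lemma sorted_preference_block:
  assumes "length a \<le> CARD('n)"
  shows "sorted_wrt (<) (preference_block a p :: 'n::{finite,linorder} list)"
proof -
  let ?us = "sorted_list_of_set (UNIV :: 'n set)"
  have "sorted_wrt (<) (filter (\<lambda>i. a ! i = Suc p) [0..<length a])"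
    by (intro sorted_wrt_filter) simp
  then have "sorted_wrt (\<lambda>i j. ?us ! i < ?us ! j) (filter (\<lambda>i. a ! i = Suc p) [0..<length a])"
  proof (rule sorted_wrt_mono_rel[rotated])
    fix i j
    assume "j \<in> set (filter (\<lambda>i. a ! i = Suc p) [0..<length a])" "i < j"
    moreover have "sorted_wrt (<) ?us" by simp
    ultimately show "?us ! i < ?us ! j" using assms by (simp add: sorted_wrt_iff_nth_less)
  qed
  then show ?thesis by (simp add: preference_block_def sorted_wrt_map)
qed

lemma preference_blocks_in_block_sequences:
  assumes "a \<in> parking_functions CARD('n)"
  shows "(preference_blocks a :: 'n::{finite,linorder} list list) \<in> block_sequences"
proof -
  let ?n = "CARD('n)" and ?us = "sorted_list_of_set (UNIV :: 'n set)"
  let ?Bs = "preference_blocks a :: 'n list list"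
  have l: "length a = ?n" and s: "set a \<subseteq> {1..?n}"
    and park: "\<forall>p\<le>?n. p \<le> card {i. i < ?n \<and> a ! i \<le> p}"
    using assms by (simp_all add: parking_functions_iff)
  have ai: "1 \<le> a ! i" "a ! i \<le> ?n" if "i < ?n" for i using s l that nth_mem[of i a] by fastforce+
  have eq: "{i. i < length a \<and> a ! i \<in> {1..p}} = {i. i < ?n \<and> a ! i \<le> p}" for p
    using ai l by auto
  have "length (concat ?Bs) = card {i. i < ?n \<and> a ! i \<le> ?n}"
    using length_concat_preference_blocks[of ?n a, where 'n = 'n] unfolding eq
    by (simp add: preference_blocks_def)
  also have "{i. i < ?n \<and> a ! i \<le> ?n} = {..<?n}" using ai by auto
  finally have "length (concat ?Bs) = ?n" by simp
  then have "parks 0 ?Bs"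
    unfolding parks_iff using park length_concat_preference_blocks[of _ a, where 'n = 'n] unfolding eq
    by (simp add: preference_blocks_def)
  moreover have "set (concat ?Bs) = UNIV"
  proof (intro equalityI subsetI)
    fix x :: 'n
    have "x \<in> set ?us" by simp
    then obtain i where i: "i < ?n" "x = ?us ! i" by (metis in_set_conv_nth length_sorted_list_of_set)
    then have "x \<in> set (preference_block a (a ! i - 1))" "a ! i - 1 < ?n"
      using ai[OF i(1)] l by (auto simp: set_preference_block)
    then show "x \<in> set (concat ?Bs)" by (auto simp: preference_blocks_def)
  qed simp
  moreover have "sorted_wrt (<) (preference_block a p :: 'n list)" for p
    using l by (intro sorted_preference_block) simp
  ultimately show ?thesis by (auto simp: block_sequences_def preference_blocks_def)
qed

lemma inj_on_preference_blocks:
  "inj_on (preference_blocks :: nat list \<Rightarrow> 'n::{finite,linorder} list list) (parking_functions CARD('n))"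
proof (rule inj_onI)
  let ?n = "CARD('n)" and ?us = "sorted_list_of_set (UNIV :: 'n set)"
  fix a b assume ab: "a \<in> parking_functions ?n" "b \<in> parking_functions ?n"
    "(preference_blocks a :: 'n list list) = preference_blocks b"
  have l: "length a = ?n" "length b = ?n" and s: "set a \<subseteq> {1..?n}"
    using ab by (auto simp: parking_functions_iff)
  show "a = b"
  proof (rule nth_equalityI)
    fix i assume i: "i < length a"
    then have p: "1 \<le> a ! i" "a ! i \<le> ?n" using s nth_mem[of i a] by fastforce+
    then have "(preference_block a (a ! i - 1) :: 'n list) = preference_block b (a ! i - 1)"
      using ab(3) by (simp add: preference_blocks_def)
    moreover have "?us ! i \<in> set (preference_block a (a ! i - 1))"
      using i p by (auto simp: set_preference_block)
    ultimately have "?us ! i \<in> set (preference_block b (a ! i - 1))" by simp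
    then obtain j where j: "j < ?n" "b ! j = a ! i" "?us ! i = ?us ! j"
      using l p by (auto simp: set_preference_block)
    then have "i = j" using i l by (simp add: nth_eq_iff_index_eq)
    then show "a ! i = b ! i" using j by simp
  qed (simp add: l)
qed

text \<open>Every letter lies in exactly one block, and the position of that block is its preference.\<close>

lemma preference_blocks_surj:
  fixes Bs :: "'n::{finite,linorder} list list"
  assumes "Bs \<in> block_sequences"
  shows "\<exists>a\<in>parking_functions CARD('n). preference_blocks a = Bs"
proof -
  let ?n = "CARD('n)" and ?us = "sorted_list_of_set (UNIV :: 'n set)"
  have lB: "length Bs = ?n" and pk: "parks 0 Bs" and cov: "set (concat Bs) = UNIV"
    and srt: "\<forall>B\<in>set Bs. sorted_wrt (<) B"
    using assms by (auto simp: block_sequences_def)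
  have ex: "\<exists>p<?n. x \<in> set (Bs ! p)" for x
  proof -
    have "x \<in> set (concat Bs)" using cov by simp
    then obtain B where "B \<in> set Bs" "x \<in> set B" by auto
    then show ?thesis using lB by (metis in_set_conv_nth)
  qed
  define pos where "pos x = (SOME p. p < ?n \<and> x \<in> set (Bs ! p))" for x
  have pos: "pos x < ?n" "x \<in> set (Bs ! pos x)" for x
    using someI_ex[OF ex[of x]] by (simp_all add: pos_def)
  have uniq: "p = pos x" if "p < ?n" "x \<in> set (Bs ! p)" for p x
  proof (rule ccontr)
    have "q < r \<Longrightarrow> r < ?n \<Longrightarrow> set (Bs ! q) \<inter> set (Bs ! r) = {}" for q r
      using block_sequences_distinct[OF assms] lB
    proof -
      assume qr: "q < r" "r < ?n"
      have "Bs = take r Bs @ Bs ! r # drop (Suc r) Bs" using qr lB by (simp add: id_take_nth_drop)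
      then have "distinct (concat (take r Bs @ Bs ! r # drop (Suc r) Bs))"
        using block_sequences_distinct[OF assms] by simp
      moreover have "Bs ! q \<in> set (take r Bs)" using qr lB by (auto simp: in_set_conv_nth)
      ultimately show ?thesis by fastforce
    qed
    moreover assume "p \<noteq> pos x"
    ultimately show False using that pos[of x] by (metis disjoint_iff linorder_neqE_nat)
  qed
  define a where "a = map (\<lambda>x. Suc (pos x)) ?us"
  have la: "length a = ?n" by (simp add: a_def)
  have ai: "a ! i = Suc (pos (?us ! i))" if "i < ?n" for i using that by (simp add: a_def)
  have sa: "set a \<subseteq> {1..?n}" using pos(1) by (auto simp: a_def Suc_le_eq)
  have "preference_block a p = Bs ! p" if p: "p < ?n" for p
  proof (rule strict_sorted_equal[symmetric])
    show "sorted_wrt (<) (preference_block a p :: 'n list)" using la by (intro sorted_preference_block) simp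
    show "sorted_wrt (<) (Bs ! p)" using srt p lB by simp
    show "set (Bs ! p) = set (preference_block a p)"
    proof (intro equalityI subsetI)
      fix x assume x: "x \<in> set (Bs ! p)"
      have "x \<in> set ?us" by simp
      then obtain i where i: "i < ?n" "x = ?us ! i" by (metis in_set_conv_nth length_sorted_list_of_set)
      then show "x \<in> set (preference_block a p)"
        using uniq[OF p x] ai la by (auto simp: set_preference_block)
    next
      fix x :: 'n assume "x \<in> set (preference_block a p)"
      then show "x \<in> set (Bs ! p)" using ai la pos(2) by (auto simp: set_preference_block)
    qed
  qed
  then have eq: "preference_blocks a = Bs"
    using lB by (auto simp: preference_blocks_def intro: nth_equalityI)
  have "p \<le> card {i. i < ?n \<and> a ! i \<le> p}" if p: "p \<le> ?n" for p
  proof -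
    have "p \<le> length (concat (take p Bs))" using pk p lB by (simp add: parks_iff)
    also have "\<dots> = card {i. i < length a \<and> a ! i \<in> {1..p}}"
      using length_concat_preference_blocks[OF p, of a] eq by simp
    also have "\<dots> \<le> card {i. i < ?n \<and> a ! i \<le> p}" using la by (intro card_mono) auto
    finally show ?thesis .
  qed
  then have "a \<in> parking_functions ?n" using la sa by (simp add: parking_functions_iff)
  then show ?thesis using eq by blast
qed

lemma empty_preference_blocks:
  assumes "a \<in> parking_functions CARD('n)"
  shows "length (filter (\<lambda>B. B = []) (preference_blocks a :: 'n::{finite,linorder} list list)) =
    CARD('n) - num_distinct a"
proof -
  let ?n = "CARD('n)"
  have l: "length a = ?n" and s: "set a \<subseteq> {1..?n}"
    using assms by (simp_all add: parking_functions_iff)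
  have e: "(preference_block a p :: 'n list) = [] \<longleftrightarrow> Suc p \<notin> set a" for p
    by (auto simp: preference_block_def filter_empty_conv in_set_conv_nth)
  have "length (filter (\<lambda>B. B = []) (preference_blocks a :: 'n list list)) =
    card {p. p < ?n \<and> Suc p \<notin> set a}"
    by (simp add: preference_blocks_def filter_map comp_def e length_filter_conv_card)
      (rule arg_cong[of _ _ card], auto)
  also have "\<dots> = card ({1..?n} - set a)"
  proof -
    have "Suc ` {p. p < ?n \<and> Suc p \<notin> set a} = {1..?n} - set a"
    proof (intro equalityI subsetI)
      fix v assume "v \<in> {1..?n} - set a"
      then show "v \<in> Suc ` {p. p < ?n \<and> Suc p \<notin> set a}" by (cases v) auto
    qed auto
    moreover have "card (Suc ` {p. p < ?n \<and> Suc p \<notin> set a}) = card {p. p < ?n \<and> Suc p \<notin> set a}"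
      by (rule card_image) simp
    ultimately show ?thesis by simp
  qed
  also have "\<dots> = ?n - num_distinct a"
    using s by (simp add: card_Diff_subset num_distinct_def)
  finally show ?thesis .
qed

lemma sum_blocks_eq_parking:
  "(\<Sum>Bs\<in>(block_sequences :: 'n::{finite,linorder} list list set). g (length (filter (\<lambda>B. B = []) Bs))) =
   (\<Sum>a\<in>parking_functions CARD('n). g (CARD('n) - num_distinct a))"
proof -
  have "bij_betw (preference_blocks :: nat list \<Rightarrow> 'n list list) (parking_functions CARD('n)) block_sequences"
    unfolding bij_betw_def
    using inj_on_preference_blocks preference_blocks_in_block_sequences preference_blocks_surj by blast
  from sum.reindex_bij_betw[OF this, symmetric]
  have "(\<Sum>Bs\<in>(block_sequences :: 'n list list set). g (length (filter (\<lambda>B. B = []) Bs))) =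
    (\<Sum>a\<in>parking_functions CARD('n).
      g (length (filter (\<lambda>B. B = []) (preference_blocks a :: 'n list list))))" .
  then show ?thesis by (simp add: empty_preference_blocks)
qed

section \<open>The enumeration\<close>

theorem theorem2:
  fixes S :: "(real ^ 'n::{finite,linorder}) set set" and n :: nat
  assumes "S = shi_arrangement" and "n = CARD('n)"
  shows "(\<Sum>R\<in>regions S. monom 1 (card (ceilings S R)) :: rat poly)
           = (\<Sum>R\<in>regions S. monom 1 (card (floors S R)))
       \<and> (\<Sum>R\<in>regions S. monom 1 (card (floors S R)) :: rat poly)
           = smult (1 / (of_nat n + 1)) (\<Sum>a\<in>all_sequences n. monom 1 (n - num_distinct a))
       \<and> smult (1 / (of_nat n + 1)) (\<Sum>a\<in>all_sequences n. monom 1 (n - num_distinct a))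
           = (\<Sum>a\<in>parking_functions n. monom 1 (n - num_distinct a) :: rat poly)"
proof -
  let ?D = "\<Sum>(w, A)\<in>(arc_diagrams :: ('n list \<times> ('n \<times> 'n) set) set). monom 1 (card A) :: rat poly"
  let ?P = "\<Sum>a\<in>parking_functions n. monom 1 (n - num_distinct a) :: rat poly"
  have "(\<Sum>R\<in>regions S. monom 1 (card (ceilings S R)) :: rat poly) = ?D"
    unfolding assms(1) by (rule sum_regions_ceilings)
  moreover have "(\<Sum>R\<in>regions S. monom 1 (card (floors S R)) :: rat poly) = ?D"
    unfolding assms(1) by (rule sum_regions_floors)
  moreover have "?D = ?P"
    unfolding assms(2) sum_arc_diagrams_eq_blocks by (rule sum_blocks_eq_parking)
  moreover have "smult (1 / (of_nat n + 1)) (\<Sum>a\<in>all_sequences n. monom 1 (n - num_distinct a)) = ?P"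
  proof -
    have "(\<Sum>a\<in>all_sequences n. monom 1 (n - num_distinct a)) = (of_nat n + 1) * ?P"
      by (rule sum_all_sequences_eq_parking)
    also have "\<dots> = smult (of_nat n + 1) ?P"
      by (simp add: of_nat_poly algebra_simps smult_add_left)
    finally show ?thesis
      by (simp add: add_nonneg_eq_0_iff)
  qed
  ultimately show ?thesis by simp
qed

end
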